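(* Let $n\ge 1$, $t_0\in\mathbb{R}$, and let $P,Q,R,S:[t_0,+\infty)\to\mathbb{C}^{n\times n}$ be continuous. Let $t_1\ge t_0$ and let $Z(t)$ be a $t_1$-normal solution of the matrix Riccati equation $$Z'+ZP(t)Z+Q(t)Z+ZR(t)+S(t)=0,\qquad t\ge t_0. \quad (\mathrm{E})$$ In order that (E) has a $t_1$-extremal solution it is necessary and sufficient that $\Omega_Z(t_1)\ne\emptyset$. If this condition holds, then all $t_1$-extremal solutions $Z_\Lambda(t)$ of (E) are given by the formula $$Z_\Lambda(t)=Z(t)+\Psi_Z^{-1}(t)\,[I+\Lambda\mu_Z(t_1,t)]^{-1}\Lambda\,\Phi_Z^{-1}(t),\qquad t\ge t_1,\quad \Lambda\in\Omega_Z(t_1).$$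
   Context: Standing assumption: there is some $t_1'\ge t_0$ for which (E) has at least two $t_1'$-regular solutions. A solution $Z(t)$ of (E) is called $t_1$-regular if it exists on $[t_1,+\infty)$. A $t_1$-regular solution $Z(t)$ is called $t_1$-normal if there exists a neighborhood $U(Z(t_1))$ of $Z(t_1)$ in $\mathbb{C}^{n\times n}$ such that every solution $\widetilde Z(t)$ of (E) with $\widetilde Z(t_1)\in U(Z(t_1))$ is also $t_1$-regular; otherwise $Z(t)$ is called $t_1$-extremal. For a $t_1$-regular solution $Z(t)$ of (E), $\Phi_Z(t)$ and $\Psi_Z(t)$ denote the solutions on $[t_1,+\infty)$ of the linear matrix equations $$\Phi'=[P(t)Z(t)+R(t)]\Phi,\qquad \Psi'=\Psi[Z(t)P(t)+Q(t)]$$ with $\Phi_Z(t_1)=\Psi_Z(t_1)=I$ (the $n\times n$ identity matrix); both are invertible for all $t\ge t_1$. Further, $$\mu_Z(t_1,t)=\int_{t_1}^{t}\Phi_Z^{-1}(\tau)P(\tau)\Psi_Z^{-1}(\tau)\,d\tau,\qquad t\ge t_1.$$ $\Omega_Z(t_1)$ denotes the set of all matrices $\Lambda\in\mathbb{C}^{n\times n}$ satisfying both conditions: ($\alpha$) $\det[I+\Lambda\mu_Z(t_1,t)]\ne0$ for all $t\ge t_1$; ($\beta$) there exists an $n\times n$ matrix $K$ which is a limiting matrix of $\mu_Z(t_1,t)$ as $t\to+\infty$ (i.e. $K=\lim_{m\to\infty}\mu_Z(t_1,s_m)$ for some sequence $s_m\to+\infty$) such that $\det[I+\Lambda K]=0$.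 *)

theory Defs
  imports "HOL-Analysis.Analysis"
begin

definition riccati_solution_on ::
  "(real \<Rightarrow> complex^'n^'n) \<Rightarrow> (real \<Rightarrow> complex^'n^'n) \<Rightarrow> (real \<Rightarrow> complex^'n^'n) \<Rightarrow>
   (real \<Rightarrow> complex^'n^'n) \<Rightarrow> real set \<Rightarrow> (real \<Rightarrow> complex^'n^'n) \<Rightarrow> bool"
  where "riccati_solution_on P Q R S J Z \<longleftrightarrow>
    (\<forall>t\<in>J. (Z has_vector_derivative
       - (Z t ** P t ** Z t + Q t ** Z t + Z t ** R t + S t)) (at t within J))"

text \<open>
  An (unqualified) solution of the equation on \<open>[t0, \<infinity>)\<close> is a noncontinuable one, together
  with its interval of existence \<open>J\<close>; the values of \<open>Z\<close> outside \<open>J\<close> are irrelevant.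
\<close>

definition riccati_maximal_solution ::
  "(real \<Rightarrow> complex^'n^'n) \<Rightarrow> (real \<Rightarrow> complex^'n^'n) \<Rightarrow> (real \<Rightarrow> complex^'n^'n) \<Rightarrow>
   (real \<Rightarrow> complex^'n^'n) \<Rightarrow> real \<Rightarrow> real set \<Rightarrow> (real \<Rightarrow> complex^'n^'n) \<Rightarrow> bool"
  where "riccati_maximal_solution P Q R S t0 J Z \<longleftrightarrow>
    is_interval J \<and> J \<noteq> {} \<and> J \<subseteq> {t0..} \<and> riccati_solution_on P Q R S J Z \<and>
    (\<forall>J' Z'. is_interval J' \<and> J \<subseteq> J' \<and> J' \<subseteq> {t0..} \<and> riccati_solution_on P Q R S J' Z' \<and>
       (\<forall>t\<in>J. Z' t = Z t) \<longrightarrow> J' = J)"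

definition riccati_regular ::
  "(real \<Rightarrow> complex^'n^'n) \<Rightarrow> (real \<Rightarrow> complex^'n^'n) \<Rightarrow> (real \<Rightarrow> complex^'n^'n) \<Rightarrow>
   (real \<Rightarrow> complex^'n^'n) \<Rightarrow> real \<Rightarrow> (real \<Rightarrow> complex^'n^'n) \<Rightarrow> bool"
  where "riccati_regular P Q R S t1 Z \<longleftrightarrow> riccati_solution_on P Q R S {t1..} Z"

text \<open>
  For a noncontinuable solution \<open>W\<close> on \<open>J\<close> with \<open>t1 \<in> J\<close>, the condition
  \<open>riccati_regular P Q R S t1 W\<close> amounts to \<open>{t1..} \<subseteq> J\<close>: a function solving the equation on
  both \<open>J\<close> and \<open>{t1..}\<close> solves it on their union.
\<close>

definition riccati_normal ::
  "(real \<Rightarrow> complex^'n^'n) \<Rightarrow> (real \<Rightarrow> complex^'n^'n) \<Rightarrow> (real \<Rightarrow> complex^'n^'n) \<Rightarrow>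
   (real \<Rightarrow> complex^'n^'n) \<Rightarrow> real \<Rightarrow> real \<Rightarrow> (real \<Rightarrow> complex^'n^'n) \<Rightarrow> bool"
  where "riccati_normal P Q R S t0 t1 Z \<longleftrightarrow>
    riccati_regular P Q R S t1 Z \<and>
    (\<exists>U. open U \<and> Z t1 \<in> U \<and>
      (\<forall>J W. riccati_maximal_solution P Q R S t0 J W \<and> t1 \<in> J \<and> W t1 \<in> U \<longrightarrow>
         riccati_regular P Q R S t1 W))"

definition riccati_extremal ::
  "(real \<Rightarrow> complex^'n^'n) \<Rightarrow> (real \<Rightarrow> complex^'n^'n) \<Rightarrow> (real \<Rightarrow> complex^'n^'n) \<Rightarrow>
   (real \<Rightarrow> complex^'n^'n) \<Rightarrow> real \<Rightarrow> real \<Rightarrow> (real \<Rightarrow> complex^'n^'n) \<Rightarrow> bool"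
  where "riccati_extremal P Q R S t0 t1 Z \<longleftrightarrow>
    riccati_regular P Q R S t1 Z \<and> \<not> riccati_normal P Q R S t0 t1 Z"

text \<open>
  The linear initial value problems below determine \<open>\<Phi>\<close> and \<open>\<Psi>\<close> on \<open>[t1, \<infinity>)\<close> only, hence
  the use of \<open>SOME\<close> rather than \<open>THE\<close>.
\<close>

definition Phi ::
  "(real \<Rightarrow> complex^'n^'n) \<Rightarrow> (real \<Rightarrow> complex^'n^'n) \<Rightarrow> (real \<Rightarrow> complex^'n^'n) \<Rightarrow>
   real \<Rightarrow> real \<Rightarrow> complex^'n^'n"
  where "Phi P R Z t1 = (SOME F. F t1 = mat 1 \<and>
    (\<forall>t\<ge>t1. (F has_vector_derivative (P t ** Z t + R t) ** F t) (at t within {t1..})))"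

definition Psi ::
  "(real \<Rightarrow> complex^'n^'n) \<Rightarrow> (real \<Rightarrow> complex^'n^'n) \<Rightarrow> (real \<Rightarrow> complex^'n^'n) \<Rightarrow>
   real \<Rightarrow> real \<Rightarrow> complex^'n^'n"
  where "Psi P Q Z t1 = (SOME F. F t1 = mat 1 \<and>
    (\<forall>t\<ge>t1. (F has_vector_derivative F t ** (Z t ** P t + Q t)) (at t within {t1..})))"

definition mu ::
  "(real \<Rightarrow> complex^'n^'n) \<Rightarrow> (real \<Rightarrow> complex^'n^'n) \<Rightarrow> (real \<Rightarrow> complex^'n^'n) \<Rightarrow>
   (real \<Rightarrow> complex^'n^'n) \<Rightarrow> real \<Rightarrow> real \<Rightarrow> complex^'n^'n"
  where "mu P Q R Z t1 t = integral {t1..t}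
    (\<lambda>\<tau>. matrix_inv (Phi P R Z t1 \<tau>) ** P \<tau> ** matrix_inv (Psi P Q Z t1 \<tau>))"

definition limiting_matrix :: "(real \<Rightarrow> complex^'n^'n) \<Rightarrow> complex^'n^'n \<Rightarrow> bool"
  where "limiting_matrix M K \<longleftrightarrow>
    (\<exists>s :: nat \<Rightarrow> real. filterlim s at_top sequentially \<and> (\<lambda>m. M (s m)) \<longlonglongrightarrow> K)"

definition Omega ::
  "(real \<Rightarrow> complex^'n^'n) \<Rightarrow> (real \<Rightarrow> complex^'n^'n) \<Rightarrow> (real \<Rightarrow> complex^'n^'n) \<Rightarrow>
   (real \<Rightarrow> complex^'n^'n) \<Rightarrow> real \<Rightarrow> (complex^'n^'n) set"
  where "Omega P Q R Z t1 = {\<Lambda>.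
    (\<forall>t\<ge>t1. det (mat 1 + \<Lambda> ** mu P Q R Z t1 t) \<noteq> 0) \<and>
    (\<exists>K. limiting_matrix (mu P Q R Z t1) K \<and> det (mat 1 + \<Lambda> ** K) = 0)}"

end

(*
  Substituting W = Z + Psi^-1 L Phi^-1 turns the Riccati equation into L' = - L mu' L, so the
  solution with L(t1) = Lambda is L = (I + Lambda mu)^-1 Lambda, and it is t1-regular if and only
  if Lambda lies in the set A of matrices with det (I + Lambda mu(t)) nonzero for all t >= t1.
  Hence W is t1-normal iff Lambda is an interior point of A, and t1-extremal iff it is a
  non-interior point of A.

  Since Z is normal, 0 is interior to A; testing with small rank-one Lambda shows that mu is
  bounded. If Lambda in A is not interior, there are Lambda_m -> Lambda and s_m with
  det (I + Lambda_m mu(s_m)) = 0; here s_m -> infinity because on compact time intervals the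
  determinant stays nonzero near Lambda, and a limit point K of mu(s_m) has
  det (I + Lambda K) = 0. Conversely, from such a K a small perturbation of Lambda makes
  I + Lambda mu(s_m) singular for large m.
*)

theory Submission
  imports Defs
begin

subsection \<open>Linear differential equations\<close>

text \<open>These are the increments of the successive approximations, not the approximations
  themselves; the solution is their sum over \<open>k\<close>.\<close>

primrec picard_term :: "(real \<Rightarrow> 'a::banach \<Rightarrow>\<^sub>L 'a) \<Rightarrow> 'a \<Rightarrow> real \<Rightarrow> nat \<Rightarrow> real \<Rightarrow> 'a" where
  "picard_term L x0 a 0 t = x0"
| "picard_term L x0 a (Suc k) t = integral {a..t} (\<lambda>s. blinfun_apply (L s) (picard_term L x0 a k s))"

lemma picard_term_continuous_on:
  assumes "continuous_on {a..T} L"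
  shows "continuous_on {a..T} (picard_term L x0 a k)"
proof (induction k)
  case (Suc k)
  have "continuous_on {a..T} (\<lambda>s. blinfun_apply (L s) (picard_term L x0 a k s))"
    by (intro continuous_intros assms Suc)
  then show ?case
    by (auto intro!: indefinite_integral_continuous_1 integrable_continuous_real)
qed (auto intro: continuous_intros)

lemma picard_term_has_vector_derivative:
  assumes "continuous_on {a..T} L" "t \<in> {a..T}"
  shows "(picard_term L x0 a (Suc k) has_vector_derivative
    blinfun_apply (L t) (picard_term L x0 a k t)) (at t within {a..T})"
proof -
  have "continuous_on {a..T} (\<lambda>s. blinfun_apply (L s) (picard_term L x0 a k s))"
    by (intro continuous_intros assms picard_term_continuous_on)
  from integral_has_vector_derivative[OF this assms(2)] show ?thesis
    by (simp add: picard_term.simps(2)[abs_def])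
qed

text \<open>Each integration of \<open>(s - a) ^ k / fact k\<close> raises the degree and the
  factorial by one, so the terms are dominated by those of an exponential series.\<close>

lemma norm_picard_term_le:
  assumes L: "continuous_on {a..T} L" and M: "\<And>t. t \<in> {a..T} \<Longrightarrow> norm (L t) \<le> M"
    and "t \<in> {a..T}"
  shows "norm (picard_term L x0 a k t) \<le> norm x0 * ((M * (t - a)) ^ k / fact k)"
  using assms(3)
proof (induction k arbitrary: t)
  case (Suc k)
  have M0: "0 \<le> M" using M[OF Suc.prems] norm_ge_zero order_trans by blast
  have cont: "continuous_on {a..t} (\<lambda>s. blinfun_apply (L s) (picard_term L x0 a k s))"
    using Suc.prems
    by (intro continuous_intros continuous_on_subset[OF L]
        continuous_on_subset[OF picard_term_continuous_on[OF L]]) auto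
  let ?g = "\<lambda>s. M * (norm x0 * ((M * (s - a)) ^ k / fact k))"
  let ?G = "\<lambda>s. norm x0 * ((M * (s - a)) ^ Suc k / fact (Suc k))"
  have fct: "real (k + 1) * (fact k :: real) = fact (Suc k)" by simp
  have "((\<lambda>s. ?G s) has_vector_derivative ?g s) (at s within {a..t})" for s
    unfolding has_real_derivative_iff_has_vector_derivative[symmetric]
    by (rule derivative_eq_intros refl | simp)+
  then have int: "(?g has_integral ?G t - ?G a) {a..t}"
    using Suc.prems by (intro fundamental_theorem_of_calculus) auto
  have "norm (integral {a..t} (\<lambda>s. blinfun_apply (L s) (picard_term L x0 a k s)))
      \<le> integral {a..t} ?g"
  proof (rule integral_norm_bound_integral)
    show "norm (blinfun_apply (L s) (picard_term L x0 a k s)) \<le> ?g s" if "s \<in> {a..t}" for s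
    proof -
      have s: "s \<in> {a..T}" using that Suc.prems by auto
      have "norm (blinfun_apply (L s) (picard_term L x0 a k s))
          \<le> norm (L s) * norm (picard_term L x0 a k s)"
        by (rule norm_blinfun)
      also have "\<dots> \<le> ?g s"
        by (intro mult_mono M[OF s] Suc.IH[OF s] M0) auto
      finally show ?thesis .
    qed
  qed (use cont int in \<open>auto intro: integrable_continuous_real\<close>)
  also have "\<dots> = ?G t"
    unfolding integral_unique[OF int] by simp
  finally show ?case by simp
qed simp

text \<open>One series defines \<open>x\<close> on the whole half-line, so nothing has to be glued;
  compact intervals \<open>{a..T}\<close> serve to bound \<open>L\<close> and to differentiate the
  series termwise.\<close>

lemma linear_ode_solution_exists:
  fixes L :: "real \<Rightarrow> 'a::banach \<Rightarrow>\<^sub>L 'a"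
  assumes L: "continuous_on {a..} L"
  shows "\<exists>x. x a = x0 \<and>
    (\<forall>t\<ge>a. (x has_vector_derivative blinfun_apply (L t) (x t)) (at t within {a..}))"
proof -
  define u where "u = picard_term L x0 a"
  define x where "x t = (\<Sum>k. u k t)" for t
  have main: "(x has_vector_derivative blinfun_apply (L t) (x t)) (at t within {a..T})"
    if t: "t \<in> {a..T}" for t T
  proof -
    have LT: "continuous_on {a..T} L" by (rule continuous_on_subset[OF L]) auto
    have "bounded (L ` {a..T})"
      by (intro compact_imp_bounded compact_continuous_image LT) auto
    then obtain M where M0: "M > 0" and M: "\<And>s. s \<in> {a..T} \<Longrightarrow> norm (L s) \<le> M"
      by (auto simp: bounded_pos)
    define b where "b k = norm x0 * ((M * (T - a)) ^ k / fact k)" for k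
    have ub: "norm (u k s) \<le> b k" if "s \<in> {a..T}" for k s
    proof -
      have "norm (u k s) \<le> norm x0 * ((M * (s - a)) ^ k / fact k)"
        unfolding u_def by (rule norm_picard_term_le[OF LT M that])
      also have "\<dots> \<le> b k"
        unfolding b_def using that M0
        by (intro mult_left_mono divide_right_mono power_mono) auto
      finally show ?thesis .
    qed
    have "summable b"
      unfolding b_def using summable_exp[of "M * (T - a)"]
      by (intro summable_mult) (simp add: field_simps)
    then have ul: "uniform_limit {a..T} (\<lambda>n s. \<Sum>k<n. u k s) x sequentially"
      unfolding x_def[abs_def] by (intro Weierstrass_m_test) (auto intro: ub)
    have sum_u: "(\<lambda>k. u k s) sums x s" if "s \<in> {a..T}" for s
      using tendsto_uniform_limitI[OF ul that] by (simp add: sums_def)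
    \<comment> \<open>Dropping the constant term \<open>x0\<close> shifts the series by one, so that
      the derivative of its \<open>k\<close>-th term is \<open>L s\<close> applied to
      \<open>u k s\<close>.\<close>
    have sum_Su: "(\<lambda>k. u (Suc k) s) sums (x s - x0)" if "s \<in> {a..T}" for s
      using sum_u[OF that] sums_Suc_iff[of "\<lambda>k. u k s" "x s - x0"] by (simp add: u_def)
    have "\<exists>g. \<forall>s\<in>{a..T}. (\<lambda>n. u (Suc n) s) sums g s \<and>
        (g has_derivative (\<lambda>h. h *\<^sub>R blinfun_apply (L s) (x s))) (at s within {a..T})"
    proof (rule has_derivative_series[where f' = "\<lambda>n s h. h *\<^sub>R blinfun_apply (L s) (u n s)"])
      show "(u (Suc n) has_derivative (\<lambda>h. h *\<^sub>R blinfun_apply (L s) (u n s))) (at s within {a..T})"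
        if "s \<in> {a..T}" for n s
        using picard_term_has_vector_derivative[OF LT that]
        unfolding u_def has_vector_derivative_def .
      \<comment> \<open>The error in the derivatives is \<open>L s\<close> applied to the error of
        the partial sum, hence at most \<open>M\<close> times it; this explains the tolerance
        \<open>e / M\<close>.\<close>
      show "\<forall>\<^sub>F n in sequentially. \<forall>s\<in>{a..T}. \<forall>h.
          norm ((\<Sum>i<n. h *\<^sub>R blinfun_apply (L s) (u i s)) - h *\<^sub>R blinfun_apply (L s) (x s))
          \<le> e * norm h"
        if "e > 0" for e
      proof -
        have "e / M > 0" using that M0 by simp
        from uniform_limitD[OF ul this] show ?thesis
        proof eventually_elim
          case (elim n)
          show ?case
          proof (intro ballI allI)
            fix s h assume s: "s \<in> {a..T}"
            have "(\<Sum>i<n. h *\<^sub>R blinfun_apply (L s) (u i s)) - h *\<^sub>R blinfun_apply (L s) (x s)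
                = h *\<^sub>R blinfun_apply (L s) ((\<Sum>i<n. u i s) - x s)"
              by (simp add: scaleR_right.sum blinfun.sum_right blinfun.diff_right
                  real_vector.scale_right_diff_distrib)
            also have "norm \<dots> \<le> \<bar>h\<bar> * (norm (L s) * norm ((\<Sum>i<n. u i s) - x s))"
              by (auto intro!: mult_left_mono norm_blinfun)
            also have "\<dots> \<le> \<bar>h\<bar> * (M * (e / M))"
              using elim s M M0 unfolding dist_norm
              by (intro mult_left_mono mult_mono) (auto intro: less_imp_le)
            finally show "norm ((\<Sum>i<n. h *\<^sub>R blinfun_apply (L s) (u i s))
                - h *\<^sub>R blinfun_apply (L s) (x s)) \<le> e * norm h"
              using M0 by (simp add: mult.commute)
          qed
        qed
      qed
    qed (use t sum_Su in auto)
    then obtain g where g: "\<And>s. s \<in> {a..T} \<Longrightarrow> (\<lambda>n. u (Suc n) s) sums g s"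
      "\<And>s. s \<in> {a..T} \<Longrightarrow> (g has_vector_derivative blinfun_apply (L s) (x s)) (at s within {a..T})"
      unfolding has_vector_derivative_def by blast
    \<comment> \<open>Termwise differentiation only yields some sum \<open>g\<close>; uniqueness of
      sums identifies it with \<open>x - x0\<close>.\<close>
    have eq: "x s = x0 + g s" if "s \<in> {a..T}" for s
      using sums_unique2[OF sum_Su[OF that] g(1)[OF that]] by (simp add: algebra_simps)
    have "((\<lambda>s. x0 + g s) has_vector_derivative blinfun_apply (L t) (x t)) (at t within {a..T})"
      using has_vector_derivative_add[OF has_vector_derivative_const g(2)[OF t]] by simp
    then show ?thesis
      by (rule has_vector_derivative_transform[OF t eq, rotated])
  qed
  have "x a = x0"
  proof -
    have "u (Suc k) a = 0" for k by (simp add: u_def)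
    then have "(\<lambda>k. u (Suc k) a) sums 0" by simp
    then have "(\<lambda>k. u k a) sums (0 + u 0 a)" by (subst (asm) sums_Suc_iff) simp
    then show ?thesis unfolding x_def by (simp add: sums_iff u_def)
  qed
  moreover have "(x has_vector_derivative blinfun_apply (L t) (x t)) (at t within {a..})"
    if "a \<le> t" for t
  proof -
    \<comment> \<open>The right end \<open>t + 1\<close> keeps \<open>t\<close> away from the right
      endpoint, so both sets look alike near \<open>t\<close>.\<close>
    have "at t within {a..} = at t within {a..t + 1}"
      by (rule at_within_nhd[of _ "{t - 1<..<t + 1}"]) auto
    then show ?thesis using main[of t "t + 1"] that by simp
  qed
  ultimately show ?thesis by blast
qed

section \<open>Uniqueness for linear equations\<close>

text \<open>Gronwall argument in energy form: by Cauchy-Schwarz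
  \<open>exp (- 2 * M * s) * (x s \<bullet> x s)\<close> is nonincreasing; it is nonnegative and
  starts at 0.\<close>

lemma linear_growth_zero:
  fixes x :: "real \<Rightarrow> 'a::real_inner"
  assumes der: "\<And>t. t \<in> {a..b} \<Longrightarrow> (x has_vector_derivative y t) (at t within {a..b})"
    and bound: "\<And>t. t \<in> {a..b} \<Longrightarrow> norm (y t) \<le> M * norm (x t)"
    and "x a = 0" "t \<in> {a..b}"
  shows "x t = 0"
proof -
  let ?f = "\<lambda>s. exp (- 2 * M * s) * (x s \<bullet> x s)"
  let ?f' = "\<lambda>s. exp (- 2 * M * s) * (2 * (x s \<bullet> y s) - 2 * M * (x s \<bullet> x s))"
  have "((\<lambda>s. x s \<bullet> x s) has_vector_derivative x s \<bullet> y s + y s \<bullet> x s) (at s within {a..b})"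
    if "s \<in> {a..b}" for s
    by (rule bounded_bilinear.has_vector_derivative[OF bounded_bilinear_inner der[OF that] der[OF that]])
  then have inn: "((\<lambda>s. x s \<bullet> x s) has_real_derivative 2 * (x s \<bullet> y s)) (at s within {a..b})"
    if "s \<in> {a..b}" for s
    using that by (simp add: has_real_derivative_iff_has_vector_derivative inner_commute)
  have ex: "((\<lambda>s. exp (- 2 * M * s)) has_real_derivative exp (- 2 * M * s) * (- 2 * M))
      (at s within {a..b})" for s
    by (rule derivative_eq_intros refl | simp)+
  have f_ab: "(?f has_real_derivative ?f' s) (at s within {a..b})" if "s \<in> {a..b}" for s
    using DERIV_mult[OF ex inn[OF that]] by (rule DERIV_cong) (simp add: algebra_simps)
  have f: "(?f has_real_derivative ?f' s) (at s within {a..t})" if "s \<in> {a..t}" for s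
  proof (rule DERIV_subset[OF f_ab])
    show "s \<in> {a..b}" "{a..t} \<subseteq> {a..b}" using that assms(4) by auto
  qed
  have neg: "?f' s \<le> 0" if "s \<in> {a..t}" for s
  proof -
    have s: "s \<in> {a..b}" using that assms(4) by auto
    have "x s \<bullet> y s \<le> norm (x s) * norm (y s)" by (rule norm_cauchy_schwarz)
    also have "\<dots> \<le> norm (x s) * (M * norm (x s))"
      by (intro mult_left_mono bound s) auto
    also have "\<dots> = M * (x s \<bullet> x s)" by (simp add: dot_square_norm power2_eq_square)
    finally show ?thesis by (simp add: mult_nonneg_nonpos)
  qed
  have "(?f' has_integral ?f t - ?f a) {a..t}"
    using assms(4)
    by (intro fundamental_theorem_of_calculus
        f[unfolded has_real_derivative_iff_has_vector_derivative]) auto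
  then have "?f t - ?f a \<le> 0"
    by (rule has_integral_le[OF _ has_integral_0]) (rule neg)
  then have "exp (- 2 * M * t) * (x t \<bullet> x t) \<le> 0"
    using \<open>x a = 0\<close> by simp
  then show ?thesis
    by (simp add: mult_le_0_iff) (metis inner_eq_zero_iff inner_ge_zero order_antisym)
qed

subsection \<open>Complex matrices\<close>

lemma norm_axis: "norm (axis i x :: 'a::real_normed_vector^'n) = norm x"
proof -
  have "(norm ((axis i x :: 'a^'n) $ j))\<^sup>2 = (if j = i then (norm x)\<^sup>2 else 0)" for j
    by (simp add: axis_def)
  then show ?thesis by (simp add: norm_vec_def L2_set_def)
qed

lemma bounded_bilinear_matrix_matrix_mult:
  "bounded_bilinear ((\<lambda>A B. A ** B) :: complex^'n^'m \<Rightarrow> complex^'p^'n \<Rightarrow> complex^'p^'m)"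
  unfolding bilinear_conv_bounded_bilinear[symmetric] bilinear_def
  by (auto intro!: linearI simp: matrix_matrix_mult_def vec_eq_iff algebra_simps
      sum.distrib scaleR_sum_right)

interpretation matmul: bounded_bilinear
  "(\<lambda>A B. A ** B) :: complex^'n^'n \<Rightarrow> complex^'n^'n \<Rightarrow> complex^'n^'n"
  by (rule bounded_bilinear_matrix_matrix_mult)

lemma matrix_inv_nonsingular:
  fixes A :: "'a::field^'n^'n"
  assumes "det A \<noteq> 0"
  shows "A ** matrix_inv A = mat 1" "matrix_inv A ** A = mat 1"
proof -
  have "\<exists>B. A ** B = mat 1 \<and> B ** A = mat 1"
    using assms by (metis invertible_def invertible_det_nz)
  from someI_ex[OF this] show "A ** matrix_inv A = mat 1" "matrix_inv A ** A = mat 1"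
    by (auto simp: matrix_inv_def)
qed

lemma matrix_inv_eqI:
  fixes A B :: "'a::field^'n^'n"
  assumes "B ** A = mat 1"
  shows "det A \<noteq> 0" "matrix_inv A = B"
proof -
  show d: "det A \<noteq> 0"
    using assms by (metis invertible_det_nz invertible_left_inverse)
  have "B = B ** (A ** matrix_inv A)" using matrix_inv_nonsingular[OF d] by simp
  also have "\<dots> = matrix_inv A" using assms by (simp add: matrix_mul_assoc)
  finally show "matrix_inv A = B" by simp
qed

lemma det_eq_0_iff_kernel:
  fixes A :: "'a::field^'n^'n"
  shows "det A = 0 \<longleftrightarrow> (\<exists>v. v \<noteq> 0 \<and> A *v v = 0)"
  using matrix_left_invertible_ker[of A] invertible_left_inverse[of A] invertible_det_nz[of A]
  by blast

section \<open>Continuity and differentiability of matrix inversion\<close>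

lemma tendsto_det:
  fixes f :: "'b \<Rightarrow> complex^'n^'n"
  assumes "(f \<longlongrightarrow> A) F"
  shows "((\<lambda>x. det (f x)) \<longlongrightarrow> det A) F"
  unfolding det_def by (intro tendsto_intros assms)

text \<open>Cramer's rule makes every entry of the inverse a quotient of determinants. The formula
  is valid where \<open>f x\<close> is nonsingular, which holds eventually.\<close>

lemma tendsto_matrix_inv:
  fixes f :: "'b \<Rightarrow> complex^'n^'n"
  assumes f: "(f \<longlongrightarrow> A) F" and A: "det A \<noteq> 0"
  shows "((\<lambda>x. matrix_inv (f x)) \<longlongrightarrow> matrix_inv A) F"
proof -
  let ?c = "\<lambda>B k j. det (\<chi> i l. if l = k then axis j 1 $ i else B $ i $ l) / det (B :: complex^'n^'n)"
  have inv: "matrix_inv B = (\<chi> k j. ?c B k j)" if "det B \<noteq> 0" for B :: "complex^'n^'n"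
  proof -
    have "matrix_inv B *v axis j 1 = (\<chi> k. ?c B k j)" for j
      by (subst cramer[OF that, symmetric])
        (simp add: matrix_vector_mul_assoc matrix_inv_nonsingular[OF that])
    moreover have "matrix_inv B $ k $ j = (matrix_inv B *v axis j 1) $ k" for k j
      by (simp add: matrix_vector_mult_def axis_def if_distrib[where f = "\<lambda>x. _ * x"] cong: if_cong)
    ultimately show ?thesis
      by (simp add: vec_eq_iff)
  qed
  have "\<forall>\<^sub>F x in F. det (f x) \<noteq> 0"
    by (rule tendsto_imp_eventually_ne[OF tendsto_det[OF f] A])
  then have "\<forall>\<^sub>F x in F. (\<chi> k j. ?c (f x) k j) = matrix_inv (f x)"
    by eventually_elim (simp add: inv)
  moreover have "((\<lambda>x. (if l = k then axis j 1 $ i else f x $ i $ l)) \<longlongrightarrow>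
      (if l = k then axis j 1 $ i else A $ i $ l)) F" for i j k l
    by (auto intro!: tendsto_intros f)
  then have "((\<lambda>x. (\<chi> k j. ?c (f x) k j)) \<longlongrightarrow> (\<chi> k j. ?c A k j)) F"
    by (intro tendsto_vec_lambda tendsto_divide tendsto_det f A)
  ultimately show ?thesis
    unfolding inv[OF A] by (rule Lim_transform_eventually[rotated])
qed

lemma has_vector_derivative_continuous_on:
  assumes "\<And>t. t \<in> S \<Longrightarrow> (f has_vector_derivative f' t) (at t within S)"
  shows "continuous_on S f"
  unfolding continuous_on_eq_continuous_within
  using has_vector_derivative_continuous[OF assms] by blast

text \<open>As a plain limit, the derivative is accessible to product rules for limits and to the
  splitting of a limit over a union of sets.\<close>

lemma has_vector_derivative_iff_quotient:
  "(f has_vector_derivative D) (at x within S) \<longleftrightarrow>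
    ((\<lambda>y. (1 / (y - x)) *\<^sub>R (f y - f x)) \<longlongrightarrow> D) (at x within S)"
proof -
  have "norm (f y - f x - (y - x) *\<^sub>R D) / norm (y - x) = norm ((1 / (y - x)) *\<^sub>R (f y - f x) - D)"
    if "y \<noteq> x" for y
  proof -
    have "(1 / (y - x)) *\<^sub>R (f y - f x) - D = (1 / (y - x)) *\<^sub>R (f y - f x - (y - x) *\<^sub>R D)"
      using that by (simp add: real_vector.scale_right_diff_distrib)
    then show ?thesis by simp
  qed
  then have "((\<lambda>y. norm (f y - f x - (y - x) *\<^sub>R D) / norm (y - x)) \<longlongrightarrow> 0) (at x within S) \<longleftrightarrow>
     ((\<lambda>y. norm ((1 / (y - x)) *\<^sub>R (f y - f x) - D)) \<longlongrightarrow> 0) (at x within S)"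
    by (intro filterlim_cong refl) (auto simp: eventually_at_filter)
  then show ?thesis
    unfolding has_vector_derivative_def has_derivative_iff_norm
    by (simp add: bounded_linear_scaleR_left tendsto_norm_zero_iff LIM_zero_iff)
qed

text \<open>Divide the identity V(s) - V(t) = - V(s) (Y(s) - Y(t)) V(t), with V the inverse of Y, by
  s - t and use the continuity of inversion.\<close>

lemma has_vector_derivative_matrix_inv:
  fixes Y :: "real \<Rightarrow> complex^'n^'n"
  assumes Y: "(Y has_vector_derivative Y') (at t within S)"
    and "t \<in> S" and ns: "\<And>s. s \<in> S \<Longrightarrow> det (Y s) \<noteq> 0"
  shows "((\<lambda>s. matrix_inv (Y s)) has_vector_derivative
    - (matrix_inv (Y t) ** Y' ** matrix_inv (Y t))) (at t within S)"
proof -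
  let ?V = "\<lambda>s. matrix_inv (Y s)"
  have V: "(?V \<longlongrightarrow> ?V t) (at t within S)"
    using has_vector_derivative_continuous[OF Y] ns[OF \<open>t \<in> S\<close>]
    by (intro tendsto_matrix_inv) (auto simp: continuous_within)
  have q: "((\<lambda>s. (1 / (s - t)) *\<^sub>R (Y s - Y t)) \<longlongrightarrow> Y') (at t within S)"
    using Y by (simp add: has_vector_derivative_iff_quotient)
  have "((\<lambda>s. - (?V s ** ((1 / (s - t)) *\<^sub>R (Y s - Y t)) ** ?V t))
      \<longlongrightarrow> - (?V t ** Y' ** ?V t)) (at t within S)"
    by (intro tendsto_minus matmul.tendsto V q tendsto_const)
  moreover have "- (?V s ** ((1 / (s - t)) *\<^sub>R (Y s - Y t)) ** ?V t) =
      (1 / (s - t)) *\<^sub>R (?V s - ?V t)" if "s \<in> S" for s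
  proof -
    have "- (?V s ** (Y s - Y t) ** ?V t) = ?V s ** (Y t ** ?V t) - (?V s ** Y s) ** ?V t"
      by (simp add: matmul.diff_left matmul.diff_right matrix_mul_assoc)
    also have "\<dots> = ?V s - ?V t"
      using matrix_inv_nonsingular[OF ns[OF that]] matrix_inv_nonsingular[OF ns[OF \<open>t \<in> S\<close>]]
      by simp
    finally show ?thesis
      by (simp add: matmul.scaleR_left matmul.scaleR_right flip: scaleR_minus_right)
  qed
  then have "\<forall>\<^sub>F s in at t within S. - (?V s ** ((1 / (s - t)) *\<^sub>R (Y s - Y t)) ** ?V t) =
      (1 / (s - t)) *\<^sub>R (?V s - ?V t)"
    by (simp add: eventually_at_filter)
  ultimately show ?thesis
    unfolding has_vector_derivative_iff_quotient by (rule Lim_transform_eventually)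
qed

subsection \<open>Linear matrix differential equations\<close>

lemma matrix_ode_solution_exists:
  fixes A :: "real \<Rightarrow> complex^'n^'n"
  assumes A: "continuous_on {a..} A"
  shows "\<exists>F. F a = F0 \<and> (\<forall>t\<ge>a. (F has_vector_derivative A t ** F t) (at t within {a..}))"
    and "\<exists>F. F a = F0 \<and> (\<forall>t\<ge>a. (F has_vector_derivative F t ** A t) (at t within {a..}))"
proof -
  \<comment> \<open>\<open>matmul.prod_left (A t)\<close> has the left factor as its variable: it is
    multiplication by \<open>A t\<close> on the right.\<close>
  have "continuous_on {a..} (\<lambda>t. matmul.prod_left (A t))"
    by (intro bounded_linear.continuous_on[OF matmul.bounded_linear_prod_left] A)
  from linear_ode_solution_exists[OF this, of F0]
  show "\<exists>F. F a = F0 \<and> (\<forall>t\<ge>a. (F has_vector_derivative F t ** A t) (at t within {a..}))"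
    by (simp add: matmul.prod_left.rep_eq)
  have "continuous_on {a..} (\<lambda>t. matmul.prod_right (A t))"
    by (intro bounded_linear.continuous_on[OF matmul.bounded_linear_prod_right] A)
  from linear_ode_solution_exists[OF this, of F0]
  show "\<exists>F. F a = F0 \<and> (\<forall>t\<ge>a. (F has_vector_derivative A t ** F t) (at t within {a..}))"
    by (simp add: matmul.prod_right.rep_eq)
qed

lemma matrix_ode_zero:
  fixes H B :: "real \<Rightarrow> complex^'n^'n"
  assumes der: "\<And>t. t \<in> {a..b} \<Longrightarrow> (H has_vector_derivative H t ** B t) (at t within {a..b})"
    and B: "continuous_on {a..b} B" and "H a = 0" "t \<in> {a..b}"
  shows "H t = 0"
proof -
  obtain C where C: "C > 0"
    "\<And>(X :: complex^'n^'n) (Y :: complex^'n^'n). norm (X ** Y) \<le> norm X * norm Y * C"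
    using matmul.pos_bounded by blast
  have "bounded (B ` {a..b})"
    by (intro compact_imp_bounded compact_continuous_image B) auto
  then obtain M where M: "M > 0" "\<And>s. s \<in> {a..b} \<Longrightarrow> norm (B s) \<le> M"
    by (auto simp: bounded_pos)
  show ?thesis
  proof (rule linear_growth_zero[OF der])
    show "norm (H s ** B s) \<le> (M * C) * norm (H s)" if "s \<in> {a..b}" for s
    proof -
      have "norm (H s ** B s) \<le> norm (H s) * norm (B s) * C" by (rule C)
      also have "\<dots> \<le> norm (H s) * M * C"
        using C M that by (intro mult_right_mono mult_left_mono) auto
      finally show ?thesis by (simp add: mult_ac)
    qed
  qed (use assms in auto)
qed

section \<open>Inverses of fundamental matrices\<close>

text \<open>The solution X of the adjoint equation X' = - X A with X(a) = I satisfies (X F)' = 0, so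
  X F = I throughout. This gives invertibility and the derivative of the inverse at once.\<close>

lemma fundamental_matrix_inverse_left:
  fixes F A :: "real \<Rightarrow> complex^'n^'n"
  assumes A: "continuous_on {a..} A" and F0: "F a = mat 1"
    and F: "\<And>t. t \<ge> a \<Longrightarrow> (F has_vector_derivative A t ** F t) (at t within {a..})"
    and "t \<ge> a"
  shows "det (F t) \<noteq> 0"
    and "((\<lambda>s. matrix_inv (F s)) has_vector_derivative - (matrix_inv (F t) ** A t)) (at t within {a..})"
proof -
  have "continuous_on {a..} (\<lambda>t. - A t)" by (intro continuous_intros A)
  then obtain X where X0: "X a = mat 1"
    and X: "\<And>t. t \<ge> a \<Longrightarrow> (X has_vector_derivative X t ** (- A t)) (at t within {a..})"
    using matrix_ode_solution_exists(2)[of a "\<lambda>t. - A t" "mat 1"] by blast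
  have XF': "((\<lambda>s. X s ** F s) has_vector_derivative 0) (at s within {a..})" if "s \<in> {a..}" for s
    using matmul.has_vector_derivative[OF X F, of s] that
    by (simp add: matmul.minus_left matmul.minus_right matrix_mul_assoc)
  have XF: "X s ** F s = mat 1" if "s \<ge> a" for s
  proof (rule has_vector_derivative_zero_constant[OF convex_real_interval(1) XF'])
    fix c assume c: "\<And>s. s \<in> {a..} \<Longrightarrow> X s ** F s = c"
    show ?thesis using c[of s] c[of a] that X0 F0 by simp
  qed
  show "det (F t) \<noteq> 0" by (rule matrix_inv_eqI(1)[OF XF[OF \<open>t \<ge> a\<close>]])
  have inv: "matrix_inv (F s) = X s" if "s \<in> {a..}" for s
    using matrix_inv_eqI(2)[OF XF] that by simp
  have "(X has_vector_derivative - (matrix_inv (F t) ** A t)) (at t within {a..})"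
    using X[OF \<open>t \<ge> a\<close>] inv[of t] \<open>t \<ge> a\<close> by (simp add: matmul.minus_right)
  then show "((\<lambda>s. matrix_inv (F s)) has_vector_derivative - (matrix_inv (F t) ** A t)) (at t within {a..})"
    by (rule has_vector_derivative_transform[rotated 2]) (use \<open>t \<ge> a\<close> inv in simp_all)
qed

lemma fundamental_matrix_inverse_right:
  fixes F A :: "real \<Rightarrow> complex^'n^'n"
  assumes A: "continuous_on {a..} A" and F0: "F a = mat 1"
    and F: "\<And>t. t \<ge> a \<Longrightarrow> (F has_vector_derivative F t ** A t) (at t within {a..})"
    and "t \<ge> a"
  shows "det (F t) \<noteq> 0"
    and "((\<lambda>s. matrix_inv (F s)) has_vector_derivative - (A t ** matrix_inv (F t))) (at t within {a..})"
proof -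
  have "continuous_on {a..} (\<lambda>t. - A t)" by (intro continuous_intros A)
  then obtain X where X0: "X a = mat 1"
    and X: "\<And>t. t \<ge> a \<Longrightarrow> (X has_vector_derivative (- A t) ** X t) (at t within {a..})"
    using matrix_ode_solution_exists(1)[of a "\<lambda>t. - A t" "mat 1"] by blast
  have XF': "((\<lambda>s. F s ** X s) has_vector_derivative 0) (at s within {a..})" if "s \<in> {a..}" for s
    using matmul.has_vector_derivative[OF F X, of s] that
    by (simp add: matmul.minus_left matmul.minus_right matrix_mul_assoc)
  have XF0: "F s ** X s = mat 1" if "s \<ge> a" for s
  proof (rule has_vector_derivative_zero_constant[OF convex_real_interval(1) XF'])
    fix c assume c: "\<And>s. s \<in> {a..} \<Longrightarrow> F s ** X s = c"
    show ?thesis using c[of s] c[of a] that X0 F0 by simp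
  qed
  \<comment> \<open>Here the constant product is \<open>F s ** X s\<close>; for square matrices a
    right inverse is also a left one.\<close>
  have XF: "X s ** F s = mat 1" if "s \<ge> a" for s
    using XF0[OF that] matrix_left_right_inverse by blast
  show "det (F t) \<noteq> 0" by (rule matrix_inv_eqI(1)[OF XF[OF \<open>t \<ge> a\<close>]])
  have inv: "matrix_inv (F s) = X s" if "s \<in> {a..}" for s
    using matrix_inv_eqI(2)[OF XF] that by simp
  have "(X has_vector_derivative - (A t ** matrix_inv (F t))) (at t within {a..})"
    using X[OF \<open>t \<ge> a\<close>] inv[of t] \<open>t \<ge> a\<close> by (simp add: matmul.minus_left)
  then show "((\<lambda>s. matrix_inv (F s)) has_vector_derivative - (A t ** matrix_inv (F t))) (at t within {a..})"
    by (rule has_vector_derivative_transform[rotated 2]) (use \<open>t \<ge> a\<close> inv in simp_all)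
qed

subsection \<open>Extending Riccati solutions\<close>

lemma riccati_solution_on_subset:
  "riccati_solution_on P Q R S J Z \<Longrightarrow> I \<subseteq> J \<Longrightarrow> riccati_solution_on P Q R S I Z"
  unfolding riccati_solution_on_def by (meson has_vector_derivative_within_subset subsetD)

lemma riccati_solution_on_cong:
  assumes "\<And>t. t \<in> J \<Longrightarrow> Z t = W t"
  shows "riccati_solution_on P Q R S J Z \<longleftrightarrow> riccati_solution_on P Q R S J W"
proof -
  have "riccati_solution_on P Q R S J V" if "riccati_solution_on P Q R S J U"
    and eq: "\<And>t. t \<in> J \<Longrightarrow> V t = U t" for U V
    unfolding riccati_solution_on_def
  proof
    fix t assume t: "t \<in> J"
    have "(V has_vector_derivative - (U t ** P t ** U t + Q t ** U t + U t ** R t + S t))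
        (at t within J)"
    proof (rule has_vector_derivative_transform[OF t eq])
      show "(U has_vector_derivative - (U t ** P t ** U t + Q t ** U t + U t ** R t + S t))
          (at t within J)"
        using that(1) t by (simp add: riccati_solution_on_def)
    qed
    then show "(V has_vector_derivative - (V t ** P t ** V t + Q t ** V t + V t ** R t + S t))
        (at t within J)"
      by (simp add: eq[OF t])
  qed
  with assms show ?thesis by metis
qed

text \<open>A derivative within \<open>J\<close> sees \<open>J\<close> only near \<open>t\<close>,
  so a piece \<open>I\<close> that coincides with \<open>J\<close> around \<open>t\<close> decides.
  This serves the union of a chain, where the piece varies with \<open>t\<close>.\<close>

lemma riccati_solution_on_local:
  assumes "\<And>t. t \<in> J \<Longrightarrow> \<exists>U I. open U \<and> t \<in> U \<and> t \<in> I \<and> J \<inter> U = I \<inter> U \<and> I \<subseteq> J \<and>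
    riccati_solution_on P Q R S I Z"
  shows "riccati_solution_on P Q R S J Z"
  unfolding riccati_solution_on_def
proof
  fix t assume "t \<in> J"
  then obtain U I where *: "open U" "t \<in> U" "t \<in> I" "J \<inter> U = I \<inter> U"
    "riccati_solution_on P Q R S I Z"
    using assms by meson
  have "at t within J = at t within I"
    using * by (intro at_within_nhd[of t U]) auto
  with * show "(Z has_vector_derivative
      - (Z t ** P t ** Z t + Q t ** Z t + Z t ** R t + S t)) (at t within J)"
    by (simp add: riccati_solution_on_def)
qed

text \<open>Zorn's lemma, applied to the solutions on intervals that extend
  \<open>W0\<close>.\<close>

lemma riccati_maximal_extension:
  assumes "is_interval J0" "J0 \<noteq> {}" "J0 \<subseteq> {t0..}" "riccati_solution_on P Q R S J0 W0"
  shows "\<exists>J W. riccati_maximal_solution P Q R S t0 J W \<and> J0 \<subseteq> J \<and> (\<forall>t\<in>J0. W t = W0 t)"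
proof -
  \<comment> \<open>Graphs forget the values of total functions outside their intervals, and
    inclusion of graphs is exactly extension of solutions.\<close>
  define gr where "gr J W = (\<lambda>t. (t, W t)) ` J" for J :: "real set" and W :: "real \<Rightarrow> complex^'a^'a"
  have gr_le: "gr J W \<subseteq> gr J' W' \<longleftrightarrow> J \<subseteq> J' \<and> (\<forall>t\<in>J. W' t = W t)" for J W J' W'
    by (auto simp: gr_def)
  define ok where "ok J W \<longleftrightarrow> is_interval J \<and> J0 \<subseteq> J \<and> J \<subseteq> {t0..} \<and>
    riccati_solution_on P Q R S J W \<and> (\<forall>t\<in>J0. W t = W0 t)" for J W
  define \<A> where "\<A> = {gr J W |J W. ok J W}"
  have "\<exists>M\<in>\<A>. \<forall>X\<in>\<A>. M \<subseteq> X \<longrightarrow> X = M"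
  proof (rule subset_Zorn_nonempty)
    have "gr J0 W0 \<in> \<A>" using assms by (auto simp: \<A>_def ok_def)
    then show "\<A> \<noteq> {}" by blast
  next
    fix \<C> assume "\<C> \<noteq> {}" and chain: "subset.chain \<A> \<C>"
    define J where "J = fst ` \<Union>\<C>"
    \<comment> \<open>Any two graphs in the chain are comparable, so their union is single-valued
      and the description is well defined.\<close>
    define W where "W t = (THE y. (t, y) \<in> \<Union>\<C>)" for t
    have mem: "\<exists>I V. G = gr I V \<and> ok I V" if "G \<in> \<C>" for G
      using that chain unfolding \<A>_def subset.chain_def by blast
    have lin: "G \<subseteq> G' \<or> G' \<subseteq> G" if "G \<in> \<C>" "G' \<in> \<C>" for G G'
      using that chain unfolding subset.chain_def by blast
    have W: "W t = V t" "t \<in> J" if "gr I V \<in> \<C>" "t \<in> I" for I V t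
    proof -
      have tV: "(t, V t) \<in> \<Union>\<C>" using that by (auto simp: gr_def)
      then show "t \<in> J" unfolding J_def by force
      have "y = V t" if y: "(t, y) \<in> \<Union>\<C>" for y
      proof -
        from y obtain G where G: "G \<in> \<C>" "(t, y) \<in> G" by blast
        then have "(t, y) \<in> gr I V \<or> (t, V t) \<in> G"
          using lin[OF G(1) \<open>gr I V \<in> \<C>\<close>] \<open>t \<in> I\<close> by (auto simp: gr_def)
        moreover from mem[OF G(1)] obtain I' V' where "G = gr I' V'" by blast
        ultimately show ?thesis using G(2) by (auto simp: gr_def)
      qed
      with tV show "W t = V t" unfolding W_def by (intro the_equality)
    qed
    \<comment> \<open>Three points at once: the local argument below needs \<open>t\<close> and a
      neighbour on each side in one member of the chain.\<close>
    have J_cov: "\<exists>I V. gr I V \<in> \<C> \<and> ok I V \<and> a \<in> I \<and> b \<in> I \<and> c \<in> I"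
      if "a \<in> J" "b \<in> J" "c \<in> J" for a b c
    proof -
      have one: "\<exists>G\<in>\<C>. a \<in> fst ` G" if "a \<in> J" for a using that by (auto simp: J_def)
      obtain Ga Gb Gc where G: "Ga \<in> \<C>" "Gb \<in> \<C>" "Gc \<in> \<C>"
        "a \<in> fst ` Ga" "b \<in> fst ` Gb" "c \<in> fst ` Gc"
        using one[OF \<open>a \<in> J\<close>] one[OF \<open>b \<in> J\<close>] one[OF \<open>c \<in> J\<close>] by blast
      have "\<exists>G\<in>\<C>. Ga \<subseteq> G \<and> Gb \<subseteq> G \<and> Gc \<subseteq> G"
        using lin[OF G(1,2)] lin[OF G(1,3)] lin[OF G(2,3)] G(1-3)
        by (meson order_refl order_trans)
      then obtain G' where G': "G' \<in> \<C>" "{a, b, c} \<subseteq> fst ` G'"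
        using G by blast
      then obtain I V where IV: "G' = gr I V" "ok I V" using mem by blast
      then have "fst ` G' = I" by (simp add: gr_def image_image)
      with G' IV show ?thesis by (intro exI[of _ I] exI[of _ V]) simp
    qed
    have sub: "I \<subseteq> J" if "gr I V \<in> \<C>" for I V using W(2) that by blast
    obtain G where "G \<in> \<C>" using \<open>\<C> \<noteq> {}\<close> by blast
    then obtain I1 V1 where 1: "gr I1 V1 \<in> \<C>" "ok I1 V1" using mem by metis
    have "ok J W"
      unfolding ok_def
    proof (intro conjI)
      show "is_interval J"
        unfolding is_interval_1
      proof (intro ballI allI impI)
        fix a b x assume "a \<in> J" "b \<in> J" and x: "a \<le> x \<and> x \<le> b"
        with J_cov[of a b a] obtain I V where I: "gr I V \<in> \<C>" "ok I V" "a \<in> I" "b \<in> I" by blast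
        then have "x \<in> I" using x unfolding ok_def is_interval_1 by blast
        then show "x \<in> J" using sub[OF I(1)] by blast
      qed
      show "J0 \<subseteq> J" using 1 sub[OF 1(1)] by (auto simp: ok_def)
      show "J \<subseteq> {t0..}"
      proof
        fix t assume "t \<in> J"
        with J_cov[of t t t] obtain I V where "ok I V" "t \<in> I" by blast
        then show "t \<in> {t0..}" by (auto simp: ok_def)
      qed
      show "\<forall>t\<in>J0. W t = W0 t" using 1 W(1)[OF 1(1)] by (auto simp: ok_def)
      show "riccati_solution_on P Q R S J W"
      proof (rule riccati_solution_on_local)
        fix t assume t: "t \<in> J"
        \<comment> \<open>\<open>a\<close> and \<open>b\<close> are points of \<open>J\<close> on
          either side of \<open>t\<close>, or \<open>t\<close> itself if that side is empty. A
          member \<open>I\<close> containing them agrees with \<open>J\<close> on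
          \<open>{l<..<r}\<close>; on an empty side the distance 1 is arbitrary.\<close>
        define a where "a = (if \<exists>s\<in>J. s < t then SOME s. s \<in> J \<and> s < t else t)"
        define b where "b = (if \<exists>s\<in>J. s > t then SOME s. s \<in> J \<and> s > t else t)"
        define l where "l = (if a < t then a else t - 1)"
        define r where "r = (if b > t then b else t + 1)"
        have a: "a \<in> J" "a < t \<or> a = t \<and> (\<forall>s\<in>J. s \<ge> t)"
          using t someI_ex[of "\<lambda>s. s \<in> J \<and> s < t"] by (auto simp: a_def not_less)
        have b: "b \<in> J" "b > t \<or> b = t \<and> (\<forall>s\<in>J. s \<le> t)"
          using t someI_ex[of "\<lambda>s. s \<in> J \<and> s > t"] by (auto simp: b_def not_less)
        obtain I V where I: "gr I V \<in> \<C>" "ok I V" "a \<in> I" "b \<in> I" "t \<in> I"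
          using J_cov[OF a(1) b(1) t] by blast
        have ab: "x \<in> I" if "a \<le> x" "x \<le> b" for x
          using that I unfolding ok_def is_interval_1 by blast
        have "J \<inter> {l<..<r} = I \<inter> {l<..<r}"
        proof
          show "I \<inter> {l<..<r} \<subseteq> J \<inter> {l<..<r}" using sub[OF I(1)] by blast
          show "J \<inter> {l<..<r} \<subseteq> I \<inter> {l<..<r}"
            using a b ab by (force simp: l_def r_def split: if_splits)
        qed
        moreover have "riccati_solution_on P Q R S I W"
          using I(2) W(1)[OF I(1)] riccati_solution_on_cong[of I W V] by (auto simp: ok_def)
        moreover have "t \<in> {l<..<r}" by (auto simp: l_def r_def)
        ultimately show "\<exists>U I. open U \<and> t \<in> U \<and> t \<in> I \<and> J \<inter> U = I \<inter> U \<and> I \<subseteq> J \<and>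
            riccati_solution_on P Q R S I W"
          using I(5) sub[OF I(1)] by (intro exI[of _ "{l<..<r}"] exI[of _ I]) simp
      qed
    qed
    moreover have "\<Union>\<C> = gr J W"
    proof
      show "gr J W \<subseteq> \<Union>\<C>"
      proof
        fix p assume "p \<in> gr J W"
        then obtain t where t: "t \<in> J" "p = (t, W t)" by (auto simp: gr_def)
        with J_cov[of t t t] obtain I V where "gr I V \<in> \<C>" "t \<in> I" by blast
        then show "p \<in> \<Union>\<C>" using t W(1)[of I V t] by (auto simp: gr_def)
      qed
      show "\<Union>\<C> \<subseteq> gr J W"
      proof
        fix p assume "p \<in> \<Union>\<C>"
        then obtain G where "G \<in> \<C>" "p \<in> G" by blast
        with mem obtain I V where I: "gr I V \<in> \<C>" "p \<in> gr I V" by metis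
        then show "p \<in> gr J W" using W[OF I(1)] by (auto simp: gr_def)
      qed
    qed
    ultimately show "\<Union>\<C> \<in> \<A>" unfolding \<A>_def by blast
  qed
  then obtain M where "M \<in> \<A>" and M: "\<And>X. X \<in> \<A> \<Longrightarrow> M \<subseteq> X \<Longrightarrow> X = M"
    by blast
  then obtain J W where JW: "ok J W" "M = gr J W" by (auto simp: \<A>_def)
  \<comment> \<open>Maximality of the graph gives noncontinuability: the graph of an extension lies
    in \<open>\<A>\<close>, hence equals \<open>M\<close>, and projection recovers the
    interval.\<close>
  have "J' = J" if "is_interval J'" "J \<subseteq> J'" "J' \<subseteq> {t0..}" "riccati_solution_on P Q R S J' Z'"
    "\<forall>t\<in>J. Z' t = W t" for J' Z'
  proof -
    have "ok J' Z'" using that JW(1) by (auto simp: ok_def)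
    then have "gr J' Z' \<in> \<A>" by (auto simp: \<A>_def)
    moreover have "M \<subseteq> gr J' Z'" using that JW(2) gr_le by simp
    ultimately have "gr J' Z' = gr J W" using M JW(2) by blast
    then have "fst ` gr J' Z' = fst ` gr J W" by simp
    then show ?thesis by (simp add: gr_def image_image)
  qed
  then have "riccati_maximal_solution P Q R S t0 J W"
    using JW(1) \<open>J0 \<noteq> {}\<close> unfolding riccati_maximal_solution_def ok_def by (intro conjI) auto
  then show ?thesis using JW(1) by (auto simp: ok_def)
qed

lemma riccati_solution_on_glue:
  assumes J: "is_interval J" "t1 \<in> J" and W: "riccati_solution_on P Q R S J W"
    and V: "riccati_solution_on P Q R S {t1..} V"
    and eq: "\<And>t. t \<in> J \<Longrightarrow> t1 \<le> t \<Longrightarrow> W t = V t"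
  shows "riccati_solution_on P Q R S (J \<union> {t1..}) (\<lambda>t. if t \<in> J then W t else V t)"
proof -
  let ?Z = "\<lambda>t. if t \<in> J then W t else V t"
  have ZJ: "riccati_solution_on P Q R S J ?Z"
    using W riccati_solution_on_cong[of J ?Z W] by simp
  have ZV: "riccati_solution_on P Q R S {t1..} ?Z"
    using V riccati_solution_on_cong[of "{t1..}" ?Z V] eq by simp
  show ?thesis
    unfolding riccati_solution_on_def
  proof
    fix t assume t: "t \<in> J \<union> {t1..}"
    let ?r = "- (?Z t ** P t ** ?Z t + Q t ** ?Z t + ?Z t ** R t + S t)"
    consider "t < t1" | "t = t1" | "t > t1" by linarith
    then show "(?Z has_vector_derivative ?r) (at t within J \<union> {t1..})"
    proof cases
      case 1
      then have "at t within J \<union> {t1..} = at t within J"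
        by (intro at_within_nhd[of t "{..<t1}"]) auto
      then show ?thesis using ZJ t 1 by (simp add: riccati_solution_on_def)
    next
      case 2
      \<comment> \<open>\<open>t1\<close> may be an endpoint of \<open>J\<close>, so neither piece
        need contain a neighbourhood of it in the union; the limits within both pieces are combined
        instead.\<close>
      have "(?Z has_vector_derivative ?r) (at t within J)"
        using ZJ J(2) unfolding 2 riccati_solution_on_def by (rule bspec)
      moreover have "(?Z has_vector_derivative ?r) (at t within {t1..})"
        using ZV unfolding 2 riccati_solution_on_def by (rule bspec) simp
      ultimately show ?thesis
        unfolding has_vector_derivative_iff_quotient Lim_within_Un by blast
    next
      case 3
      have "at t within J \<union> {t1..} = at t within {t1..}"
        using 3 by (intro at_within_nhd[of t "{t1<..}"]) auto
      then show ?thesis using ZV 3 by (simp add: riccati_solution_on_def)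
    qed
  qed
qed

subsection \<open>Solutions relative to a regular solution\<close>

text \<open>\<open>Z\<close> is the origin from which all other solutions are measured; its
  normality enters in \<open>extremal_iff\<close>.\<close>

locale riccati_reference =
  fixes P Q R S Z :: "real \<Rightarrow> complex^'n^'n" and t1 :: real
  assumes P_cont: "continuous_on {t1..} P" and Q_cont: "continuous_on {t1..} Q"
    and R_cont: "continuous_on {t1..} R" and Z_regular: "riccati_regular P Q R S t1 Z"
begin

abbreviation "\<Phi> \<equiv> Phi P R Z t1"
abbreviation "\<Psi> \<equiv> Psi P Q Z t1"
abbreviation "\<mu> \<equiv> mu P Q R Z t1"

definition F where "F t = matrix_inv (\<Phi> t)"
definition G where "G t = matrix_inv (\<Psi> t)"

text \<open>Condition (\<alpha>) alone, that is, the set A of the overview.\<close>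

definition admissible where
  "admissible \<Lambda> \<longleftrightarrow> (\<forall>t\<ge>t1. det (mat 1 + \<Lambda> ** \<mu> t) \<noteq> 0)"

definition sol where
  "sol \<Lambda> t = Z t + G t ** matrix_inv (mat 1 + \<Lambda> ** \<mu> t) ** \<Lambda> ** F t"

section \<open>The linear data attached to the reference solution\<close>

lemma Z_deriv:
  assumes "t \<ge> t1"
  shows "(Z has_vector_derivative - (Z t ** P t ** Z t + Q t ** Z t + Z t ** R t + S t))
    (at t within {t1..})"
  using Z_regular assms by (auto simp: riccati_regular_def riccati_solution_on_def)

lemma Z_cont: "continuous_on {t1..} Z"
  by (rule has_vector_derivative_continuous_on[OF Z_deriv]) simp

lemma PZR_cont: "continuous_on {t1..} (\<lambda>t. P t ** Z t + R t)"
  by (intro continuous_intros matmul.continuous_on P_cont Z_cont R_cont)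

lemma ZPQ_cont: "continuous_on {t1..} (\<lambda>t. Z t ** P t + Q t)"
  by (intro continuous_intros matmul.continuous_on P_cont Z_cont Q_cont)

lemma Phi_init: "\<Phi> t1 = mat 1"
  and Phi_deriv: "t \<ge> t1 \<Longrightarrow>
    (\<Phi> has_vector_derivative (P t ** Z t + R t) ** \<Phi> t) (at t within {t1..})"
  using someI_ex[OF matrix_ode_solution_exists(1)[OF PZR_cont, of "mat 1"]]
  unfolding Phi_def by blast+

lemma Psi_init: "\<Psi> t1 = mat 1"
  and Psi_deriv: "t \<ge> t1 \<Longrightarrow>
    (\<Psi> has_vector_derivative \<Psi> t ** (Z t ** P t + Q t)) (at t within {t1..})"
  using someI_ex[OF matrix_ode_solution_exists(2)[OF ZPQ_cont, of "mat 1"]]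
  unfolding Psi_def by blast+

lemma det_Phi: "t \<ge> t1 \<Longrightarrow> det (\<Phi> t) \<noteq> 0"
  and F_deriv: "t \<ge> t1 \<Longrightarrow>
    (F has_vector_derivative - (F t ** (P t ** Z t + R t))) (at t within {t1..})"
  using fundamental_matrix_inverse_left[OF PZR_cont Phi_init Phi_deriv]
  unfolding F_def[abs_def] by blast+

lemma det_Psi: "t \<ge> t1 \<Longrightarrow> det (\<Psi> t) \<noteq> 0"
  and G_deriv: "t \<ge> t1 \<Longrightarrow>
    (G has_vector_derivative - ((Z t ** P t + Q t) ** G t)) (at t within {t1..})"
  using fundamental_matrix_inverse_right[OF ZPQ_cont Psi_init Psi_deriv]
  unfolding G_def[abs_def] by blast+

lemma FPG_cont: "continuous_on {t1..} (\<lambda>t. F t ** P t ** G t)"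
proof -
  have "continuous_on {t1..} F"
    by (rule has_vector_derivative_continuous_on[OF F_deriv]) simp
  moreover have "continuous_on {t1..} G"
    by (rule has_vector_derivative_continuous_on[OF G_deriv]) simp
  ultimately show ?thesis by (intro matmul.continuous_on P_cont)
qed

lemma mu_init: "\<mu> t1 = 0"
  by (simp add: mu_def)

lemma mu_deriv:
  assumes "t \<ge> t1"
  shows "(\<mu> has_vector_derivative F t ** P t ** G t) (at t within {t1..})"
proof -
  have eq: "\<mu> = (\<lambda>u. integral {t1..u} (\<lambda>t. F t ** P t ** G t))"
    by (simp add: mu_def[abs_def] F_def G_def)
  have "(\<mu> has_vector_derivative F t ** P t ** G t) (at t within {t1..t + 1})"
    unfolding eq using assms
    by (intro integral_has_vector_derivative continuous_on_subset[OF FPG_cont]) auto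
  moreover have "at t within {t1..} = at t within {t1..t + 1}"
    by (rule at_within_nhd[of _ "{t - 1<..<t + 1}"]) auto
  ultimately show ?thesis by simp
qed

lemma mu_cont: "continuous_on {t1..} \<mu>"
  by (rule has_vector_derivative_continuous_on[OF mu_deriv]) simp

section \<open>Parametrization of solutions by their initial deviation from \<open>Z\<close>\<close>

lemma sol_init: "sol \<Lambda> t1 = Z t1 + \<Lambda>"
proof -
  have "matrix_inv (mat 1 :: complex^'n^'n) = mat 1" by (rule matrix_inv_eqI(2)) simp
  then show ?thesis by (simp add: sol_def F_def G_def Phi_init Psi_init mu_init)
qed

lemma sol_solves:
  assumes "I \<subseteq> {t1..}" and ns: "\<And>t. t \<in> I \<Longrightarrow> det (mat 1 + \<Lambda> ** \<mu> t) \<noteq> 0"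
  shows "riccati_solution_on P Q R S I (sol \<Lambda>)"
  unfolding riccati_solution_on_def
proof
  fix t assume t: "t \<in> I"
  then have t1: "t \<ge> t1" using assms(1) by auto
  let ?V = "\<lambda>t. matrix_inv (mat 1 + \<Lambda> ** \<mu> t)"
  let ?F = "F t" and ?G = "G t" and ?P = "P t" and ?Q = "Q t" and ?R = "R t" and ?Z = "Z t"
  have sub: "(f has_vector_derivative d) (at t within I)"
    if "(f has_vector_derivative d) (at t within {t1..})" for f :: "real \<Rightarrow> complex^'n^'n" and d
    using that assms(1) by (rule has_vector_derivative_within_subset)
  have "((\<lambda>t. mat 1 + \<Lambda> ** \<mu> t) has_vector_derivative \<Lambda> ** (?F ** ?P ** ?G)) (at t within I)"
    using has_vector_derivative_add[OF has_vector_derivative_const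
        matmul.has_vector_derivative[OF has_vector_derivative_const sub[OF mu_deriv[OF t1]]]]
    by simp
  then have V: "(?V has_vector_derivative - (?V t ** (\<Lambda> ** (?F ** ?P ** ?G)) ** ?V t)) (at t within I)"
    by (rule has_vector_derivative_matrix_inv[OF _ t ns])
  let ?D = "?G ** ?V t ** \<Lambda> ** ?F"
  \<comment> \<open>The three terms come from differentiating \<open>G\<close>, the inverse and
    \<open>F\<close> in turn; the middle one is G V \<Lambda> (F P G) V \<Lambda> F = D P D up to
    sign.\<close>
  have 1: "((\<lambda>t. G t ** ?V t ** \<Lambda> ** F t) has_vector_derivative
      - ((?Z ** ?P + ?Q) ** ?D) - ?D ** ?P ** ?D - ?D ** (?P ** ?Z + ?R)) (at t within I)"
    using matmul.has_vector_derivative[OF matmul.has_vector_derivative[OF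
        matmul.has_vector_derivative[OF sub[OF G_deriv[OF t1]] V] has_vector_derivative_const]
        sub[OF F_deriv[OF t1]], of \<Lambda>]
    by (rule has_vector_derivative_eq_rhs)
      (simp add: matmul.add_left matmul.add_right matmul.minus_left matmul.minus_right
        matmul.diff_left matmul.diff_right matrix_mul_assoc algebra_simps)
  have 2: "sol \<Lambda> t = ?Z + ?D" by (simp add: sol_def)
  show "(sol \<Lambda> has_vector_derivative
      - (sol \<Lambda> t ** P t ** sol \<Lambda> t + Q t ** sol \<Lambda> t + sol \<Lambda> t ** R t + S t)) (at t within I)"
    unfolding 2 unfolding sol_def[abs_def]
    using has_vector_derivative_add[OF sub[OF Z_deriv[OF t1]] 1]
    by (rule has_vector_derivative_eq_rhs)
      (simp add: matmul.add_left matmul.add_right matrix_mul_assoc algebra_simps)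
qed

text \<open>
  With \<open>L = \<Psi> (W - Z) \<Phi>\<close>, the matrix \<open>H = (I + \<Lambda> \<mu>) L - \<Lambda>\<close> satisfies \<open>H' = - H \<mu>' L\<close>, hence
  vanishes; then \<open>(I + \<Lambda> \<mu>) (I - L \<mu>) = I\<close>.
\<close>

lemma solution_eq_sol:
  assumes W: "riccati_solution_on P Q R S {t1..T} W" and "t1 \<le> T"
  defines "\<Lambda> \<equiv> W t1 - Z t1"
  shows "det (mat 1 + \<Lambda> ** \<mu> T) \<noteq> 0" and "W T = sol \<Lambda> T"
proof -
  \<comment> \<open>\<open>L\<close> removes the linear terms from the equation for the difference;
    conversely W - Z = G L F.\<close>
  define L where "L t = \<Psi> t ** (W t - Z t) ** \<Phi> t" for t
  define H where "H t = (mat 1 + \<Lambda> ** \<mu> t) ** L t - \<Lambda>" for t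
  define m where "m t = F t ** P t ** G t" for t
  have sub: "(f has_vector_derivative d) (at t within {t1..T})"
    if "(f has_vector_derivative d) (at t within {t1..})" for f :: "real \<Rightarrow> complex^'n^'n" and d t
    using that by (rule has_vector_derivative_within_subset) auto
  have PF: "\<Phi> t ** F t = mat 1" and GP: "G t ** \<Psi> t = mat 1" if "t \<ge> t1" for t
    using matrix_inv_nonsingular[OF det_Phi[OF that]] matrix_inv_nonsingular[OF det_Psi[OF that]]
    by (auto simp: F_def G_def)
  have L': "(L has_vector_derivative - (L t ** m t ** L t)) (at t within {t1..T})"
    if t: "t \<in> {t1..T}" for t
  proof -
    have t1: "t \<ge> t1" using t by auto
    let ?D = "W t - Z t"
    have "(W has_vector_derivative - (W t ** P t ** W t + Q t ** W t + W t ** R t + S t))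
        (at t within {t1..T})"
      using W t by (auto simp: riccati_solution_on_def)
    \<comment> \<open>Subtracting the two Riccati equations cancels \<open>S\<close> and leaves
      linear coefficients that match the equations for \<open>\<Phi>\<close> and
      \<open>\<Psi>\<close>.\<close>
    from has_vector_derivative_diff[OF this sub[OF Z_deriv[OF t1]]]
    have D: "((\<lambda>t. W t - Z t) has_vector_derivative
        - (?D ** P t ** ?D + ?D ** (P t ** Z t + R t) + (Z t ** P t + Q t) ** ?D)) (at t within {t1..T})"
      by (rule has_vector_derivative_eq_rhs)
        (simp add: matmul.add_left matmul.add_right matmul.diff_left matmul.diff_right
          matrix_mul_assoc algebra_simps)
    have "L t ** m t ** L t = \<Psi> t ** ?D ** (\<Phi> t ** F t) ** P t ** (G t ** \<Psi> t) ** ?D ** \<Phi> t"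
      by (simp add: L_def m_def matrix_mul_assoc)
    then have eq: "L t ** m t ** L t = \<Psi> t ** ?D ** P t ** ?D ** \<Phi> t"
      by (simp add: PF[OF t1] GP[OF t1])
    show ?thesis
      unfolding eq unfolding L_def[abs_def]
      using matmul.has_vector_derivative[OF matmul.has_vector_derivative[OF
          sub[OF Psi_deriv[OF t1]] D] sub[OF Phi_deriv[OF t1]]]
      by (rule has_vector_derivative_eq_rhs)
        (simp add: matmul.add_left matmul.add_right matmul.minus_left matmul.minus_right
          matmul.diff_left matmul.diff_right matrix_mul_assoc algebra_simps)
  qed
  have L_cont: "continuous_on {t1..T} L"
    using L' by (rule has_vector_derivative_continuous_on)
  \<comment> \<open>The product rule gives \<Lambda> m L - (I + \<Lambda> \<mu>) L m L, in which - H
    is a common left factor.\<close>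
  have H': "(H has_vector_derivative H t ** (- (m t ** L t))) (at t within {t1..T})"
    if t: "t \<in> {t1..T}" for t
  proof -
    have t1: "t \<ge> t1" using t by auto
    have "((\<lambda>t. mat 1 + \<Lambda> ** \<mu> t) has_vector_derivative \<Lambda> ** m t) (at t within {t1..T})"
      using has_vector_derivative_add[OF has_vector_derivative_const
          matmul.has_vector_derivative[OF has_vector_derivative_const sub[OF mu_deriv[OF t1]]]]
      by (simp add: m_def)
    from has_vector_derivative_diff[OF matmul.has_vector_derivative[OF this L'[OF t]]
        has_vector_derivative_const, of \<Lambda>]
    show ?thesis
      unfolding H_def[abs_def]
      by (rule has_vector_derivative_eq_rhs)
        (simp add: matmul.add_left matmul.minus_left matmul.minus_right matmul.diff_left
          matrix_mul_assoc algebra_simps)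
  qed
  have "H T = 0"
  proof (rule matrix_ode_zero[OF H'])
    show "continuous_on {t1..T} (\<lambda>t. - (m t ** L t))"
      unfolding m_def
      by (intro continuous_intros matmul.continuous_on L_cont continuous_on_subset[OF FPG_cont]) auto
    show "H t1 = 0"
      by (simp add: H_def L_def \<Lambda>_def mu_init Phi_init Psi_init)
  qed (use \<open>t1 \<le> T\<close> in auto)
  then have HL: "(mat 1 + \<Lambda> ** \<mu> T) ** L T = \<Lambda>" by (simp add: H_def)
  have "(mat 1 + \<Lambda> ** \<mu> T) ** (mat 1 - L T ** \<mu> T) =
      mat 1 + \<Lambda> ** \<mu> T - (mat 1 + \<Lambda> ** \<mu> T) ** L T ** \<mu> T"
    by (simp add: matmul.diff_right matrix_mul_assoc)
  also have "\<dots> = mat 1" by (simp add: HL)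
  \<comment> \<open>Nonsingularity is thus a consequence of the existence of \<open>W\<close> up to
    \<open>T\<close>, through the explicit right inverse.\<close>
  finally show ns: "det (mat 1 + \<Lambda> ** \<mu> T) \<noteq> 0"
    by (metis invertible_det_nz invertible_right_inverse)
  have "L T = matrix_inv (mat 1 + \<Lambda> ** \<mu> T) ** (mat 1 + \<Lambda> ** \<mu> T) ** L T"
    by (simp add: matrix_inv_nonsingular[OF ns])
  also have "\<dots> = matrix_inv (mat 1 + \<Lambda> ** \<mu> T) ** \<Lambda>"
    using HL by (simp add: matrix_mul_assoc[symmetric])
  finally have "G T ** matrix_inv (mat 1 + \<Lambda> ** \<mu> T) ** \<Lambda> ** F T = G T ** L T ** F T"
    by (simp add: matrix_mul_assoc)
  also have "\<dots> = (G T ** \<Psi> T) ** (W T - Z T) ** (\<Phi> T ** F T)"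
    by (simp add: L_def matrix_mul_assoc)
  also have "\<dots> = W T - Z T"
    by (simp add: PF[OF \<open>t1 \<le> T\<close>] GP[OF \<open>t1 \<le> T\<close>])
  finally show "W T = sol \<Lambda> T" by (simp add: sol_def)
qed

lemma regular_iff:
  "riccati_regular P Q R S t1 W \<longleftrightarrow>
    (\<exists>\<Lambda>. admissible \<Lambda> \<and> (\<forall>t\<ge>t1. W t = sol \<Lambda> t))"
proof
  assume W: "riccati_regular P Q R S t1 W"
  \<comment> \<open>The parameter \<open>W t1 - Z t1\<close> does not depend on \<open>T\<close>, so
    the statements on all \<open>{t1..T}\<close> fit together.\<close>
  have "riccati_solution_on P Q R S {t1..T} W" for T
    using W unfolding riccati_regular_def by (rule riccati_solution_on_subset) auto
  then show "\<exists>\<Lambda>. admissible \<Lambda> \<and> (\<forall>t\<ge>t1. W t = sol \<Lambda> t)"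
    using solution_eq_sol unfolding admissible_def by blast
next
  assume "\<exists>\<Lambda>. admissible \<Lambda> \<and> (\<forall>t\<ge>t1. W t = sol \<Lambda> t)"
  then obtain \<Lambda> where "admissible \<Lambda>" "\<forall>t\<ge>t1. W t = sol \<Lambda> t" by blast
  then show "riccati_regular P Q R S t1 W"
    using sol_solves[of "{t1..}" \<Lambda>] riccati_solution_on_cong[of "{t1..}" W "sol \<Lambda>"]
    by (auto simp: riccati_regular_def admissible_def)
qed

lemma regular_admissible:
  assumes "riccati_regular P Q R S t1 W"
  shows "admissible (W t1 - Z t1)"
proof -
  obtain \<Lambda> where \<Lambda>: "admissible \<Lambda>" "\<forall>t\<ge>t1. W t = sol \<Lambda> t"
    using assms regular_iff by blast
  then have "W t1 = Z t1 + \<Lambda>" using sol_init by auto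
  with \<Lambda> show ?thesis by simp
qed

section \<open>Normality as an interior point condition\<close>

text \<open>Translation by \<open>Z t1\<close> matches initial values with parameters. Every value
  at \<open>t1\<close> is attained by some noncontinuable solution, and one with an admissible
  parameter must reach all of \<open>{t1..}\<close>.\<close>

lemma normal_iff:
  assumes "t0 \<le> t1"
  shows "riccati_normal P Q R S t0 t1 W \<longleftrightarrow> riccati_regular P Q R S t1 W \<and>
    W t1 - Z t1 \<in> interior {\<Lambda>. admissible \<Lambda>}"
proof -
  have "(\<exists>U. open U \<and> W t1 \<in> U \<and>
      (\<forall>J V. riccati_maximal_solution P Q R S t0 J V \<and> t1 \<in> J \<and> V t1 \<in> U \<longrightarrow>
         riccati_regular P Q R S t1 V)) \<longleftrightarrow>
    W t1 - Z t1 \<in> interior {\<Lambda>. admissible \<Lambda>}" (is "?L \<longleftrightarrow> ?R")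
  proof
    assume ?L
    then obtain U where U: "open U" "W t1 \<in> U" and reg: "\<And>J V.
      riccati_maximal_solution P Q R S t0 J V \<Longrightarrow> t1 \<in> J \<Longrightarrow> V t1 \<in> U \<Longrightarrow>
        riccati_regular P Q R S t1 V"
      by blast
    show ?R
    proof (rule interiorI)
      show "open ((\<lambda>\<Lambda>. \<Lambda> + Z t1) -` U)"
        by (intro continuous_open_vimage U continuous_intros)
      show "(\<lambda>\<Lambda>. \<Lambda> + Z t1) -` U \<subseteq> {\<Lambda>. admissible \<Lambda>}"
      proof
        fix \<Lambda> assume \<Lambda>: "\<Lambda> \<in> (\<lambda>\<Lambda>. \<Lambda> + Z t1) -` U"
        \<comment> \<open>Within a single point every derivative condition is vacuous, so any
          initial value extends to a noncontinuable solution; its regularity then comes from the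
          choice of \<open>U\<close>.\<close>
        have "riccati_solution_on P Q R S {t1} (\<lambda>_. \<Lambda> + Z t1)"
          by (simp add: riccati_solution_on_def has_vector_derivative_iff_quotient)
            (simp add: at_within_def)
        from riccati_maximal_extension[OF _ _ _ this, of t0] assms
        obtain J V where "riccati_maximal_solution P Q R S t0 J V" "t1 \<in> J" "V t1 = \<Lambda> + Z t1"
          by (auto simp: is_interval_1)
        with reg[of J V] \<Lambda> have "riccati_regular P Q R S t1 V" by simp
        with regular_admissible[of V] \<open>V t1 = _\<close> show "\<Lambda> \<in> {\<Lambda>. admissible \<Lambda>}" by simp
      qed
    qed (use U in auto)
  next
    assume ?R
    then obtain U where U: "open U" "W t1 - Z t1 \<in> U" "\<And>\<Lambda>. \<Lambda> \<in> U \<Longrightarrow> admissible \<Lambda>"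
      by (auto elim!: interiorE)
    have "riccati_regular P Q R S t1 V"
      if max: "riccati_maximal_solution P Q R S t0 J V" and J: "t1 \<in> J" and V: "V t1 - Z t1 \<in> U"
      for J V
    proof -
      let ?\<Lambda> = "V t1 - Z t1"
      have int: "is_interval J" and J0: "J \<subseteq> {t0..}" and VJ: "riccati_solution_on P Q R S J V"
        using max by (auto simp: riccati_maximal_solution_def)
      have s: "riccati_solution_on P Q R S {t1..} (sol ?\<Lambda>)"
        using U(3)[OF V] by (intro sol_solves) (auto simp: admissible_def)
      have eq: "V t = sol ?\<Lambda> t" if "t \<in> J" "t1 \<le> t" for t
      proof (rule solution_eq_sol(2)[OF riccati_solution_on_subset[OF VJ] \<open>t1 \<le> t\<close>])
        show "{t1..t} \<subseteq> J"
          using int[unfolded is_interval_1, rule_format, of t1 t] J \<open>t \<in> J\<close> by auto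
      qed
      have "is_interval (J \<union> {t1..})"
        unfolding is_interval_1
      proof (intro ballI allI impI)
        fix a b x assume "a \<in> J \<union> {t1..}" and x: "a \<le> x \<and> x \<le> b"
        then have "x \<in> J" if "x < t1"
          using that int[unfolded is_interval_1, rule_format, of a t1 x] J by auto
        then show "x \<in> J \<union> {t1..}" by force
      qed
      moreover have "J \<union> {t1..} \<subseteq> {t0..}" using J0 assms by auto
      moreover note riccati_solution_on_glue[OF int J VJ s eq]
      moreover have "\<forall>t\<in>J. (if t \<in> J then V t else sol ?\<Lambda> t) = V t" by simp
      \<comment> \<open>Otherwise gluing \<open>sol\<close> onto \<open>V\<close> would continue it
        properly.\<close>
      ultimately have "J \<union> {t1..} = J"
        using max[unfolded riccati_maximal_solution_def, THEN conjunct2, THEN conjunct2,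
            THEN conjunct2, THEN conjunct2, rule_format,
            of "J \<union> {t1..}" "\<lambda>t. if t \<in> J then V t else sol ?\<Lambda> t"]
        by blast
      then show ?thesis
        using VJ riccati_solution_on_subset[of P Q R S J V "{t1..}"]
        unfolding riccati_regular_def by blast
    qed
    moreover have "open ((\<lambda>X. X - Z t1) -` U)"
      by (intro continuous_open_vimage U continuous_intros)
    ultimately show ?L
      using U(2) by (intro exI[of _ "(\<lambda>X. X - Z t1) -` U"]) auto
  qed
  then show ?thesis unfolding riccati_normal_def by simp
qed

section \<open>Boundedness of \<mu>, limiting matrices and the boundary of the admissible
  set\<close>

text \<open>
  If the entry \<open>z = \<mu>(t)\<^sub>j\<^sub>i\<close> is nonzero, then \<open>I + c E\<^sub>i\<^sub>j \<mu>(t)\<close> is singular for \<open>c = -1/z\<close>, which is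
  small when \<open>z\<close> is large.
\<close>

lemma mu_bounded:
  assumes "0 \<in> interior {\<Lambda>. admissible \<Lambda>}"
  obtains B where "\<And>t. t \<ge> t1 \<Longrightarrow> norm (\<mu> t) \<le> B"
proof -
  obtain e where e: "e > 0" "ball 0 e \<subseteq> {\<Lambda>. admissible \<Lambda>}"
    using assms by (auto simp: mem_interior)
  have entry: "norm (\<mu> t $ j $ i) \<le> 2 / e" if "t \<ge> t1" for t i j
  proof (rule ccontr)
    assume "\<not> ?thesis"
    then have big: "norm (\<mu> t $ j $ i) > 2 / e" by simp
    then have nz: "\<mu> t $ j $ i \<noteq> 0"
      using e(1) by (metis divide_pos_pos less_asym norm_zero zero_less_numeral)
    define c where "c = - 1 / (\<mu> t $ j $ i)"
    have "norm c < e"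
    proof -
      have "2 < e * norm (\<mu> t $ j $ i)" using big e(1) by (simp add: field_simps)
      then show ?thesis using nz by (simp add: c_def norm_divide field_simps)
    qed
    then have "axis i (axis j c) \<in> ball (0 :: complex^'n^'n) e"
      by (simp add: norm_axis)
    then have adm: "admissible (axis i (axis j c))" using e(2) by blast
    \<comment> \<open>The kernel vector is e_i: since E_ij \<mu> e_i = z e_i for the entry z, the
      matrix sends e_i to (1 + c z) e_i = 0.\<close>
    have 1: "(\<mu> t *v axis i 1) = (\<chi> b. \<mu> t $ b $ i)"
      by (simp add: vec_eq_iff matrix_vector_mult_def axis_def if_distrib[where f = "\<lambda>x. _ * x"]
          cong: if_cong)
    have "axis i (axis j c) *v w = axis i (c * w $ j)" for w
      by (simp add: vec_eq_iff matrix_vector_mult_def axis_def if_distrib[where f = "\<lambda>x. x * _"]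
          if_distrib[where f = "\<lambda>x. x $ _"] cong: if_cong)
    then have "(mat 1 + axis i (axis j c) ** \<mu> t) *v axis i 1 = axis i 1 + axis i (- 1)"
      using nz by (simp add: matrix_vector_mult_add_rdistrib 1 c_def flip: matrix_vector_mul_assoc)
    also have "\<dots> = 0" by (simp add: vec_eq_iff axis_def)
    finally have "det (mat 1 + axis i (axis j c) ** \<mu> t) = 0"
      unfolding det_eq_0_iff_kernel by (intro exI[of _ "axis i 1"]) (simp add: axis_eq_0_iff)
    then show False using adm that by (simp add: admissible_def)
  qed
  have "norm (\<mu> t) \<le> (\<Sum>j\<in>(UNIV::'n set). \<Sum>i\<in>(UNIV::'n set). 2 / e)" if "t \<ge> t1" for t
  proof -
    have "norm (\<mu> t) \<le> (\<Sum>j\<in>UNIV. norm (\<mu> t $ j))"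
      unfolding norm_vec_def[of "\<mu> t"] by (rule L2_set_le_sum) simp
    also have "\<dots> \<le> (\<Sum>j\<in>UNIV. \<Sum>i\<in>UNIV. norm (\<mu> t $ j $ i))"
      unfolding norm_vec_def[of "\<mu> t $ _"] by (intro sum_mono L2_set_le_sum) simp
    also have "\<dots> \<le> (\<Sum>j\<in>(UNIV::'n set). \<Sum>i\<in>(UNIV::'n set). 2 / e)"
      by (intro sum_mono entry that)
    finally show ?thesis .
  qed
  then show ?thesis by (rule that)
qed

text \<open>Otherwise singular pairs with parameters tending to \<open>\<Lambda>\<close> and times
  in the compact interval accumulate at some (\<Lambda>, l), where the determinant vanishes by
  continuity of \<mu>.\<close>

lemma admissible_near_on_compact:
  assumes "admissible \<Lambda>"
  obtains d where "d > 0"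
    "\<And>\<Lambda>' t. \<Lambda>' \<in> ball \<Lambda> d \<Longrightarrow> t \<in> {t1..T} \<Longrightarrow> det (mat 1 + \<Lambda>' ** \<mu> t) \<noteq> 0"
proof -
  have "\<exists>d>0. \<forall>\<Lambda>'\<in>ball \<Lambda> d. \<forall>t\<in>{t1..T}. det (mat 1 + \<Lambda>' ** \<mu> t) \<noteq> 0"
  proof (rule ccontr)
    assume *: "\<not> ?thesis"
    have "\<exists>\<Lambda>'\<in>ball \<Lambda> (inverse (Suc n)). \<exists>t\<in>{t1..T}. det (mat 1 + \<Lambda>' ** \<mu> t) = 0" for n
      using * inverse_Suc[of n] by blast
    then obtain X s where X: "\<And>n. X n \<in> ball \<Lambda> (inverse (Suc n))"
      and s: "\<And>n. s n \<in> {t1..T}" and det: "\<And>n. det (mat 1 + X n ** \<mu> (s n)) = 0"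
      by metis
    obtain l r where l: "l \<in> {t1..T}" and r: "strict_mono r" "(s \<circ> r) \<longlonglongrightarrow> l"
      using compact_Icc[of t1 T] s unfolding compact_def by metis
    have "X \<longlonglongrightarrow> \<Lambda>"
    proof (rule metric_tendsto_imp_tendsto[OF LIMSEQ_inverse_real_of_nat])
      show "\<forall>\<^sub>F n in sequentially. dist (X n) \<Lambda> \<le> dist (inverse (real (Suc n))) 0"
        using X by (intro always_eventually) (auto simp: dist_commute less_imp_le)
    qed
    then have "(X \<circ> r) \<longlonglongrightarrow> \<Lambda>" using r(1) by (rule LIMSEQ_subseq_LIMSEQ)
    moreover have "(\<lambda>n. \<mu> ((s \<circ> r) n)) \<longlonglongrightarrow> \<mu> l"
      using l s by (intro continuous_on_tendsto_compose[OF mu_cont r(2)]) auto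
    ultimately have "(\<lambda>n. det (mat 1 + (X \<circ> r) n ** \<mu> ((s \<circ> r) n))) \<longlonglongrightarrow> det (mat 1 + \<Lambda> ** \<mu> l)"
      by (intro tendsto_det tendsto_intros matmul.tendsto)
    then have "det (mat 1 + \<Lambda> ** \<mu> l) = 0"
      using det by (simp add: LIMSEQ_const_iff)
    then show False using assms l by (auto simp: admissible_def)
  qed
  then show ?thesis using that by blast
qed

lemma limiting_matrix_if_not_interior:
  assumes bdd: "\<And>t. t \<ge> t1 \<Longrightarrow> norm (\<mu> t) \<le> B"
    and adm: "admissible \<Lambda>" and not_int: "\<Lambda> \<notin> interior {\<Lambda>. admissible \<Lambda>}"
  shows "\<exists>K. limiting_matrix \<mu> K \<and> det (mat 1 + \<Lambda> ** K) = 0"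
proof -
  \<comment> \<open>The smaller of two radii is used: \<open>d\<close> pushes the singular time
    beyond \<open>t1 + n\<close>, and \<open>inverse (Suc n)\<close> makes the parameters converge
    to \<open>\<Lambda>\<close>.\<close>
  have "\<exists>\<Lambda>'\<in>ball \<Lambda> (inverse (Suc n)). \<exists>s\<ge>t1 + n. det (mat 1 + \<Lambda>' ** \<mu> s) = 0" for n :: nat
  proof -
    obtain d where d: "d > 0" "\<And>\<Lambda>' t. \<Lambda>' \<in> ball \<Lambda> d \<Longrightarrow> t \<in> {t1..t1 + n} \<Longrightarrow>
        det (mat 1 + \<Lambda>' ** \<mu> t) \<noteq> 0"
      using admissible_near_on_compact[OF adm] by blast
    have "\<not> ball \<Lambda> (min d (inverse (Suc n))) \<subseteq> {\<Lambda>. admissible \<Lambda>}"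
      using not_int d(1) unfolding mem_interior
      by (metis inverse_positive_iff_positive min_less_iff_conj of_nat_0_less_iff zero_less_Suc)
    then obtain \<Lambda>' s where *: "\<Lambda>' \<in> ball \<Lambda> d" "\<Lambda>' \<in> ball \<Lambda> (inverse (Suc n))"
      "s \<ge> t1" "det (mat 1 + \<Lambda>' ** \<mu> s) = 0"
      by (auto simp: admissible_def subset_iff)
    then have "s \<ge> t1 + n" using d(2)[of \<Lambda>' s] by force
    with * show ?thesis by blast
  qed
  then obtain X s where X: "\<And>n. X n \<in> ball \<Lambda> (inverse (Suc n))"
    and s: "\<And>n. s n \<ge> t1 + real n" and det: "\<And>n. det (mat 1 + X n ** \<mu> (s n)) = 0"
    by metis
  \<comment> \<open>Boundedness of \<mu> supplies the limiting matrix by compactness of the closed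
    ball.\<close>
  have "\<mu> (s n) \<in> cball 0 B" for n
    using bdd[of "s n"] s[of n] by simp
  then obtain K r where r: "strict_mono r" "((\<lambda>n. \<mu> (s n)) \<circ> r) \<longlonglongrightarrow> K"
    using compact_cball[of "0 :: complex^'n^'n" B] unfolding compact_def by metis
  have "X \<longlonglongrightarrow> \<Lambda>"
  proof (rule metric_tendsto_imp_tendsto[OF LIMSEQ_inverse_real_of_nat])
    show "\<forall>\<^sub>F n in sequentially. dist (X n) \<Lambda> \<le> dist (inverse (real (Suc n))) 0"
      using X by (intro always_eventually) (auto simp: dist_commute less_imp_le)
  qed
  then have "(X \<circ> r) \<longlonglongrightarrow> \<Lambda>" using r(1) by (rule LIMSEQ_subseq_LIMSEQ)
  with r(2) have "(\<lambda>n. det (mat 1 + (X \<circ> r) n ** ((\<lambda>n. \<mu> (s n)) \<circ> r) n)) \<longlonglongrightarrow> det (mat 1 + \<Lambda> ** K)"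
    by (intro tendsto_det tendsto_intros matmul.tendsto)
  then have "det (mat 1 + \<Lambda> ** K) = 0"
    using det by (simp add: LIMSEQ_const_iff)
  moreover have "filterlim s at_top sequentially"
  proof (rule filterlim_at_top_mono)
    show "filterlim (\<lambda>n. t1 + real n) at_top sequentially"
      by (intro filterlim_tendsto_add_at_top[OF tendsto_const] filterlim_real_sequentially)
  qed (use s in auto)
  then have "filterlim (\<lambda>n. s (r n)) at_top sequentially"
    by (rule filterlim_compose) (rule filterlim_subseq[OF r(1)])
  then have "limiting_matrix \<mu> K"
    using r(2) unfolding limiting_matrix_def by (intro exI[of _ "\<lambda>n. s (r n)"]) (simp add: o_def)
  ultimately show ?thesis by blast
qed

text \<open>
  For \<open>v\<close> in the kernel of \<open>I + \<Lambda> K\<close>, a perturbation of \<open>\<Lambda>\<close> in a single column puts \<open>v\<close> into the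
  kernel of \<open>I + \<Lambda> \<mu>(s\<^sub>m)\<close>; it is small since \<open>(I + \<Lambda> \<mu>(s\<^sub>m)) v\<close> tends to \<open>0\<close> while \<open>\<mu>(s\<^sub>m) v\<close>
  tends to \<open>K v \<noteq> 0\<close>.
\<close>

lemma not_interior_if_limiting_matrix:
  assumes "limiting_matrix \<mu> K" and K: "det (mat 1 + \<Lambda> ** K) = 0"
  shows "\<Lambda> \<notin> interior {\<Lambda>. admissible \<Lambda>}"
proof
  assume int: "\<Lambda> \<in> interior {\<Lambda>. admissible \<Lambda>}"
  obtain s where s: "filterlim s at_top sequentially" "(\<lambda>m. \<mu> (s m)) \<longlonglongrightarrow> K"
    using assms(1) by (auto simp: limiting_matrix_def)
  obtain v where v: "v \<noteq> 0" "(mat 1 + \<Lambda> ** K) *v v = 0"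
    using K by (auto simp: det_eq_0_iff_kernel)
  have "K *v v \<noteq> 0"
  proof
    assume "K *v v = 0"
    then have "(mat 1 + \<Lambda> ** K) *v v = v"
      by (simp add: matrix_vector_mult_add_rdistrib flip: matrix_vector_mul_assoc)
    with v show False by simp
  qed
  then obtain k where k: "(K *v v) $ k \<noteq> 0" by (auto simp: vec_eq_iff)
  define y where "y m = \<mu> (s m) *v v" for m
  define w where "w m = (mat 1 + \<Lambda> ** \<mu> (s m)) *v v" for m
  \<comment> \<open>Column \<open>k\<close> is chosen so that \<open>E m *v y m = - w m\<close>.
    Where \<open>y m $ k = 0\<close> the quotient is 0 by convention and this may fail, but only for
    finitely many \<open>m\<close>.\<close>
  define E where "E m = (\<chi> a b. if b = k then - (w m $ a) / y m $ k else 0)" for m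
  have mv: "(\<lambda>m. M m *v v) \<longlonglongrightarrow> A *v v" if "M \<longlonglongrightarrow> A" for M :: "nat \<Rightarrow> complex^'n^'n" and A
    unfolding matrix_vector_mult_def
    by (intro tendsto_vec_lambda tendsto_sum tendsto_mult tendsto_vec_nth that tendsto_const)
  have y: "y \<longlonglongrightarrow> K *v v"
    unfolding y_def[abs_def] by (rule mv[OF s(2)])
  have w: "w \<longlonglongrightarrow> 0"
    unfolding w_def[abs_def] v(2)[symmetric]
    by (intro mv tendsto_intros matmul.tendsto s(2))
  have "E \<longlonglongrightarrow> (\<chi> a b. if b = k then - (0 $ a) / (K *v v) $ k else 0)"
    unfolding E_def[abs_def]
  proof (intro tendsto_vec_lambda)
    fix a b :: 'n
    have "(\<lambda>m. - (w m $ a) / y m $ k) \<longlonglongrightarrow> - (0 $ a) / (K *v v) $ k"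
      by (intro tendsto_intros w y k)
    then show "(\<lambda>m. if b = k then - (w m $ a) / y m $ k else 0)
        \<longlonglongrightarrow> (if b = k then - (0 $ a) / (K *v v) $ k else 0)" by simp
  qed
  moreover have "(\<chi> a b. if b = k then - (0 $ a) / (K *v v) $ k else 0) = (0 :: complex^'n^'n)"
    by (simp add: vec_eq_iff)
  ultimately have "E \<longlonglongrightarrow> 0" by simp
  then have "(\<lambda>m. \<Lambda> + E m) \<longlonglongrightarrow> \<Lambda> + 0" by (intro tendsto_intros)
  then have "\<forall>\<^sub>F m in sequentially. \<Lambda> + E m \<in> interior {\<Lambda>. admissible \<Lambda>}"
    using int by (intro topological_tendstoD[of _ "\<Lambda> + 0"]) auto
  moreover have "\<forall>\<^sub>F m in sequentially. s m \<ge> t1"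
    using s(1) by (simp add: filterlim_at_top)
  moreover have "\<forall>\<^sub>F m in sequentially. y m $ k \<noteq> 0"
    by (rule tendsto_imp_eventually_ne[OF tendsto_vec_nth[OF y] k])
  ultimately have "\<forall>\<^sub>F m in sequentially. False"
  proof eventually_elim
    case (elim m)
    have "E m *v y m = - w m"
      using elim(3)
      by (simp add: vec_eq_iff matrix_vector_mult_def E_def if_distrib[where f = "\<lambda>x. x * _"]
          cong: if_cong)
    then have "(mat 1 + (\<Lambda> + E m) ** \<mu> (s m)) *v v = 0"
      by (simp add: w_def y_def matmul.add_left matrix_vector_mult_add_rdistrib algebra_simps
          flip: matrix_vector_mul_assoc)
    then have "det (mat 1 + (\<Lambda> + E m) ** \<mu> (s m)) = 0"
      using v(1) by (auto simp: det_eq_0_iff_kernel)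
    moreover have "admissible (\<Lambda> + E m)" using elim(1) interior_subset by blast
    ultimately show False using elim(2) by (simp add: admissible_def)
  qed
  then show False by simp
qed

section \<open>Extremal solutions\<close>

text \<open>Normality of \<open>Z\<close> puts its own parameter 0 into the interior, so \<mu> is
  bounded and \<open>Omega\<close> consists exactly of the admissible non-interior
  parameters.\<close>

lemma extremal_iff:
  assumes "t0 \<le> t1" and Z: "riccati_normal P Q R S t0 t1 Z"
  shows "riccati_extremal P Q R S t0 t1 W \<longleftrightarrow>
    (\<exists>\<Lambda>\<in>Omega P Q R Z t1. \<forall>t\<ge>t1. W t = sol \<Lambda> t)"
proof -
  have "0 \<in> interior {\<Lambda>. admissible \<Lambda>}" using Z normal_iff[OF assms(1)] by simp
  then obtain B where B: "\<And>t. t \<ge> t1 \<Longrightarrow> norm (\<mu> t) \<le> B" using mu_bounded by blast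
  have Om: "\<Lambda> \<in> Omega P Q R Z t1 \<longleftrightarrow> admissible \<Lambda> \<and> \<Lambda> \<notin> interior {\<Lambda>. admissible \<Lambda>}" for \<Lambda>
    using limiting_matrix_if_not_interior[OF B] not_interior_if_limiting_matrix
    by (auto simp: Omega_def admissible_def)
  have init: "W t1 - Z t1 = \<Lambda>" if "\<forall>t\<ge>t1. W t = sol \<Lambda> t" for \<Lambda>
    using that sol_init by auto
  have "riccati_extremal P Q R S t0 t1 W \<longleftrightarrow>
      riccati_regular P Q R S t1 W \<and> W t1 - Z t1 \<notin> interior {\<Lambda>. admissible \<Lambda>}"
    using normal_iff[OF assms(1)] by (auto simp: riccati_extremal_def)
  \<comment> \<open>Evaluation at \<open>t1\<close> recovers the parameter from the solution, so the
    \<open>\<Lambda>\<close> given by \<open>regular_iff\<close> is the one tested for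
    interiority.\<close>
  also have "\<dots> \<longleftrightarrow> (\<exists>\<Lambda>\<in>Omega P Q R Z t1. \<forall>t\<ge>t1. W t = sol \<Lambda> t)"
    unfolding regular_iff Bex_def Om using init by blast
  finally show ?thesis .
qed

end

theorem theorem3p2:
  fixes P Q R S Z :: "real \<Rightarrow> complex^'n^'n" and t0 t1 :: real
  assumes "continuous_on {t0..} P" and "continuous_on {t0..} Q"
    and "continuous_on {t0..} R" and "continuous_on {t0..} S"
    and two_regular: "\<exists>t1'\<ge>t0. \<exists>Z1 Z2. riccati_regular P Q R S t1' Z1 \<and>
      riccati_regular P Q R S t1' Z2 \<and> (\<exists>t\<ge>t1'. Z1 t \<noteq> Z2 t)"
    and "t0 \<le> t1"
    and "riccati_normal P Q R S t0 t1 Z"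
  shows "((\<exists>W. riccati_extremal P Q R S t0 t1 W) \<longleftrightarrow> Omega P Q R Z t1 \<noteq> {}) \<and>
    (Omega P Q R Z t1 \<noteq> {} \<longrightarrow>
      (\<forall>W. riccati_extremal P Q R S t0 t1 W \<longleftrightarrow>
        (\<exists>\<Lambda>\<in>Omega P Q R Z t1. \<forall>t\<ge>t1.
          W t = Z t + matrix_inv (Psi P Q Z t1 t) **
            matrix_inv (mat 1 + \<Lambda> ** mu P Q R Z t1 t) ** \<Lambda> ** matrix_inv (Phi P R Z t1 t))))"
proof -
  have "{t1..} \<subseteq> {t0..}" using \<open>t0 \<le> t1\<close> by auto
  then interpret riccati_reference P Q R S Z t1
    using assms by unfold_locales (auto intro: continuous_on_subset simp: riccati_normal_def)
  have ext: "riccati_extremal P Q R S t0 t1 W \<longleftrightarrow>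
      (\<exists>\<Lambda>\<in>Omega P Q R Z t1. \<forall>t\<ge>t1. W t = sol \<Lambda> t)" for W
    by (rule extremal_iff) fact+
  \<comment> \<open>For a given \<open>\<Lambda>\<close> in \<open>Omega\<close>,
    \<open>sol \<Lambda>\<close> itself is an extremal solution.\<close>
  then have "(\<exists>W. riccati_extremal P Q R S t0 t1 W) \<longleftrightarrow> Omega P Q R Z t1 \<noteq> {}"
    by blast
  with ext show ?thesis
    by (simp add: sol_def F_def G_def)
qed

end
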